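(* Let $L_1,L_2>0$, $M>L_2$, $0\le\rho<1$ and $\Delta\ge 0$. There exists a constant $C>0$, depending only on $L_1,L_2,M,\rho,\Delta$, with the following property. Let $f:\mathbb{R}^d\to\mathbb{R}$ satisfy Assumption A with Lipschitz constants $L_1,L_2$, let $x_0\in\mathbb{R}^d$ with $f(x_0)-f^\star=\Delta$, and let $\{x_k\}_{k\ge 0}$ be any sequence generated by the algorithm CRm with parameters $M,\rho$ started at $x_0$. Then for every $0<\epsilon\le 1$ and every integer $k$ with $$k\ \ge\ \frac{C}{\epsilon^{3/2}},$$ at least one of the iterates $x_0,\dots,x_k$ is an $\epsilon$-second-order stationary point of $f$.
   Context: Assumption A on $f:\mathbb{R}^d\to\mathbb{R}$ (with constants $L_1,L_2$): (1) $f$ is twice continuously differentiable and bounded below, $f^\star:=\inf_{x\in\mathbb{R}^d} f(x)>-\infty$; (2) for every $\alpha\in\mathbb{R}$ the sublevel set $\{x: f(x)\le\alpha\}$ is bounded; (3) $\nabla f$ is $L_1$-Lipschitz and $\nabla^2 f$ is $L_2$-Lipschitz (Euclidean norm on vectors, operator norm on matrices). The function $f$ is possibly nonconvex. A point $x$ is an $\epsilon$-second-order stationary point of $f$ if $\|\nabla f(x)\|\le\epsilon$ and $\lambda_{\min}(\nabla^2 f(x))\ge-\sqrt{\epsilon}$, where $\lambda_{\min}$ is the smallest eigenvalue. Algorithm CRm (parameters $M,\rho$; initialization $x_0=y_0\in\mathbb{R}^d$). For $k=0,1,2,\dots$: (Cubic step) $s_{k+1}\in\operatorname{argmin}_{s\in\mathbb{R}^d}\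 \nabla f(x_k)^\top s+\frac12 s^\top\nabla^2 f(x_k)s+\frac{M}{6}\|s\|^3$ (a global minimizer), and $y_{k+1}=x_k+s_{k+1}$. (Momentum step) $\beta_{k+1}=\min\{\rho,\ \|\nabla f(y_{k+1})\|,\ \|y_{k+1}-x_k\|\}$ and $v_{k+1}=y_{k+1}+\beta_{k+1}(y_{k+1}-y_k)$. (Monotone step) $x_{k+1}\in\operatorname{argmin}_{x\in\{y_{k+1},v_{k+1}\}} f(x)$. *)

theory Defs
  imports Complex_Main "Jordan_Normal_Form.Spectral_Radius"
begin

text \<open>
  \<open>\<real>\<^sup>d\<close> is the carrier \<^term>\<open>carrier_vec d :: real vec set\<close>, so that the dimension is an ordinary
  natural number and a constant can be chosen before it. An objective is a function
  \<^typ>\<open>real vec \<Rightarrow> real\<close> of which only the values on \<^term>\<open>carrier_vec d\<close> matter. These vectors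
  have no normed-space instance; the Frechet derivatives are therefore spelled out.
\<close>

definition vnorm :: "real vec \<Rightarrow> real" where
  "vnorm v = sqrt (v \<bullet> v)"

definition opnorm :: "real mat \<Rightarrow> real" where
  "opnorm A = (SUP v\<in>{v \<in> carrier_vec (dim_col A). vnorm v \<le> 1}. vnorm (A *\<^sub>v v))"

definition has_gradient :: "nat \<Rightarrow> (real vec \<Rightarrow> real) \<Rightarrow> real vec \<Rightarrow> real vec \<Rightarrow> bool" where
  "has_gradient d f g x \<longleftrightarrow> g \<in> carrier_vec d \<and>
     (\<forall>e>0. \<exists>\<delta>>0. \<forall>h\<in>carrier_vec d. vnorm h < \<delta> \<longrightarrow>
        \<bar>f (x + h) - f x - g \<bullet> h\<bar> \<le> e * vnorm h)"

definition has_jacobian :: "nat \<Rightarrow> (real vec \<Rightarrow> real vec) \<Rightarrow> real mat \<Rightarrow> real vec \<Rightarrow> bool" where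
  "has_jacobian d F H x \<longleftrightarrow> H \<in> carrier_mat d d \<and>
     (\<forall>e>0. \<exists>\<delta>>0. \<forall>h\<in>carrier_vec d. vnorm h < \<delta> \<longrightarrow>
        vnorm (F (x + h) - F x - H *\<^sub>v h) \<le> e * vnorm h)"

definition grad :: "nat \<Rightarrow> (real vec \<Rightarrow> real) \<Rightarrow> real vec \<Rightarrow> real vec" where
  "grad d f x = (THE g. has_gradient d f g x)"

definition hess :: "nat \<Rightarrow> (real vec \<Rightarrow> real) \<Rightarrow> real vec \<Rightarrow> real mat" where
  "hess d f x = (THE H. has_jacobian d (grad d f) H x)"

text \<open>
  Derivatives are unique, so the descriptions above pick out the derivative whenever it exists;
  its entries are the partial derivatives.
\<close>

lemma vnorm_smult_unit_vec:
  assumes "i < d"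
  shows "vnorm (t \<cdot>\<^sub>v unit_vec d i) = \<bar>t\<bar>"
  using assms by (simp add: vnorm_def)

lemma abs_index_le_vnorm:
  assumes "i < dim_vec v"
  shows "\<bar>v $ i\<bar> \<le> vnorm v"
proof -
  have "(v $ i)\<^sup>2 \<le> (\<Sum>j\<in>{0..<dim_vec v}. (v $ j)\<^sup>2)"
    using assms by (intro member_le_sum) auto
  then have "(v $ i)\<^sup>2 \<le> v \<bullet> v" by (simp add: scalar_prod_def power2_eq_square)
  then show ?thesis unfolding vnorm_def by (metis real_sqrt_abs real_sqrt_le_mono)
qed

lemma DERIV_if_little_o:
  fixes \<phi> :: "real \<Rightarrow> real"
  assumes "\<forall>e>0. \<exists>\<delta>>0. \<forall>t. \<bar>t\<bar> < \<delta> \<longrightarrow> \<bar>\<phi> t - \<phi> 0 - D * t\<bar> \<le> e * \<bar>t\<bar>"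
  shows "(\<phi> has_real_derivative D) (at 0)"
  unfolding DERIV_def LIM_def
proof (intro allI impI)
  fix e :: real assume "e > 0"
  with assms obtain \<delta> where d: "\<delta> > 0"
    and b: "\<And>t. \<bar>t\<bar> < \<delta> \<Longrightarrow> \<bar>\<phi> t - \<phi> 0 - D * t\<bar> \<le> e/2 * \<bar>t\<bar>"
    by (meson half_gt_zero)
  have "dist ((\<phi> (0 + t) - \<phi> 0) / t) D < e" if "t \<noteq> 0" "dist t 0 < \<delta>" for t
  proof -
    have "\<bar>(\<phi> t - \<phi> 0) / t - D\<bar> = \<bar>\<phi> t - \<phi> 0 - D * t\<bar> / \<bar>t\<bar>"
      using that by (simp add: field_simps flip: abs_divide)
    also have "\<dots> \<le> e/2" using b[of t] that by (simp add: field_simps)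
    finally show ?thesis using \<open>e > 0\<close> by (simp add: dist_real_def)
  qed
  with d show "\<exists>s>0. \<forall>t. t \<noteq> 0 \<and> dist t 0 < s \<longrightarrow> dist ((\<phi> (0 + t) - \<phi> 0) / t) D < e" by blast
qed

lemma has_gradient_partial:
  assumes g: "has_gradient d f g x" and x: "x \<in> carrier_vec d" and i: "i < d"
  shows "((\<lambda>t. f (x + t \<cdot>\<^sub>v unit_vec d i)) has_real_derivative g $ i) (at 0)"
proof (rule DERIV_if_little_o, intro allI impI)
  fix e :: real assume "e > 0"
  with g obtain \<delta> where d: "\<delta> > 0"
    and b: "\<And>h. h \<in> carrier_vec d \<Longrightarrow> vnorm h < \<delta> \<Longrightarrow> \<bar>f (x + h) - f x - g \<bullet> h\<bar> \<le> e * vnorm h"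
    and gc: "g \<in> carrier_vec d"
    unfolding has_gradient_def by meson
  have "x + 0 \<cdot>\<^sub>v unit_vec d i = x" using x by auto
  then have "\<bar>f (x + t \<cdot>\<^sub>v unit_vec d i) - f (x + 0 \<cdot>\<^sub>v unit_vec d i) - g $ i * t\<bar> \<le> e * \<bar>t\<bar>"
    if "\<bar>t\<bar> < \<delta>" for t
    using b[of "t \<cdot>\<^sub>v unit_vec d i"] that gc i by (simp add: vnorm_smult_unit_vec mult.commute)
  with d show "\<exists>\<delta>>0. \<forall>t. \<bar>t\<bar> < \<delta> \<longrightarrow>
      \<bar>f (x + t \<cdot>\<^sub>v unit_vec d i) - f (x + 0 \<cdot>\<^sub>v unit_vec d i) - g $ i * t\<bar> \<le> e * \<bar>t\<bar>" by blast
qed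

lemma has_jacobian_partial:
  assumes H: "has_jacobian d F H x" and x: "x \<in> carrier_vec d" and i: "i < d" and j: "j < d"
    and F: "\<And>z. z \<in> carrier_vec d \<Longrightarrow> F z \<in> carrier_vec d"
  shows "((\<lambda>t. F (x + t \<cdot>\<^sub>v unit_vec d j) $ i) has_real_derivative H $$ (i, j)) (at 0)"
proof (rule DERIV_if_little_o, intro allI impI)
  fix e :: real assume "e > 0"
  with H obtain \<delta> where d: "\<delta> > 0"
    and b: "\<And>h. h \<in> carrier_vec d \<Longrightarrow> vnorm h < \<delta> \<Longrightarrow>
              vnorm (F (x + h) - F x - H *\<^sub>v h) \<le> e * vnorm h"
    and Hc: "H \<in> carrier_mat d d"
    unfolding has_jacobian_def by meson
  have x0: "x + 0 \<cdot>\<^sub>v unit_vec d j = x" using x by auto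
  have "\<bar>F (x + t \<cdot>\<^sub>v unit_vec d j) $ i - F (x + 0 \<cdot>\<^sub>v unit_vec d j) $ i - H $$ (i, j) * t\<bar> \<le> e * \<bar>t\<bar>"
    if t: "\<bar>t\<bar> < \<delta>" for t
  proof -
    let ?h = "t \<cdot>\<^sub>v unit_vec d j"
    let ?r = "F (x + ?h) - F x - H *\<^sub>v ?h"
    have "F x \<in> carrier_vec d" "F (x + ?h) \<in> carrier_vec d" using F x by auto
    then have "?r $ i = F (x + ?h) $ i - F x $ i - H $$ (i, j) * t" and "i < dim_vec ?r"
      using Hc i j by (auto simp: mult.commute)
    with abs_index_le_vnorm[of i ?r] b[of ?h] t j
    show ?thesis unfolding x0 by (simp add: vnorm_smult_unit_vec)
  qed
  with d show "\<exists>\<delta>>0. \<forall>t. \<bar>t\<bar> < \<delta> \<longrightarrow>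
      \<bar>F (x + t \<cdot>\<^sub>v unit_vec d j) $ i - F (x + 0 \<cdot>\<^sub>v unit_vec d j) $ i - H $$ (i, j) * t\<bar> \<le> e * \<bar>t\<bar>"
    by blast
qed

lemma grad_eqI:
  assumes g: "has_gradient d f g x" and x: "x \<in> carrier_vec d"
  shows "grad d f x = g"
  unfolding grad_def
proof (rule the_equality)
  show "has_gradient d f g x" by (rule g)
next
  fix g' assume g': "has_gradient d f g' x"
  show "g' = g"
  proof (rule eq_vecI)
    show "dim_vec g' = dim_vec g" using g g' by (auto simp: has_gradient_def)
    show "g' $ i = g $ i" if "i < dim_vec g" for i
      using that g DERIV_unique[OF has_gradient_partial[OF g' x] has_gradient_partial[OF g x]]
      by (auto simp: has_gradient_def)
  qed
qed

lemma hess_eqI: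
  assumes H: "has_jacobian d (grad d f) H x" and x: "x \<in> carrier_vec d"
    and f: "\<And>z. z \<in> carrier_vec d \<Longrightarrow> \<exists>g. has_gradient d f g z"
  shows "hess d f x = H"
  unfolding hess_def
proof (rule the_equality)
  show "has_jacobian d (grad d f) H x" by (rule H)
next
  have F: "grad d f z \<in> carrier_vec d" if "z \<in> carrier_vec d" for z
    using f[OF that] grad_eqI[OF _ that] by (auto simp: has_gradient_def)
  fix H' assume H': "has_jacobian d (grad d f) H' x"
  show "H' = H"
  proof (rule eq_matI)
    show "dim_row H' = dim_row H" "dim_col H' = dim_col H"
      using H H' by (auto simp: has_jacobian_def)
    show "H' $$ (i, j) = H $$ (i, j)" if "i < dim_row H" "j < dim_col H" for i j
      using that H
        DERIV_unique[OF has_jacobian_partial[OF H' x _ _ F] has_jacobian_partial[OF H x _ _ F]]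
      by (auto simp: has_jacobian_def)
  qed
qed

definition twice_continuously_differentiable :: "nat \<Rightarrow> (real vec \<Rightarrow> real) \<Rightarrow> bool" where
  "twice_continuously_differentiable d f \<longleftrightarrow>
     (\<forall>x\<in>carrier_vec d. \<exists>g. has_gradient d f g x) \<and>
     (\<forall>x\<in>carrier_vec d. \<exists>H. has_jacobian d (grad d f) H x) \<and>
     (\<forall>x\<in>carrier_vec d. \<forall>e>0. \<exists>\<delta>>0. \<forall>z\<in>carrier_vec d.
        vnorm (z - x) < \<delta> \<longrightarrow> opnorm (hess d f z - hess d f x) < e)"

definition assumption_A :: "nat \<Rightarrow> (real vec \<Rightarrow> real) \<Rightarrow> real \<Rightarrow> real \<Rightarrow> bool" where
  "assumption_A d f L1 L2 \<longleftrightarrow>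
     twice_continuously_differentiable d f \<and>
     bdd_below (f ` carrier_vec d) \<and>
     (\<forall>\<alpha>. \<exists>B. \<forall>x\<in>carrier_vec d. f x \<le> \<alpha> \<longrightarrow> vnorm x \<le> B) \<and>
     (\<forall>x\<in>carrier_vec d. \<forall>z\<in>carrier_vec d.
        vnorm (grad d f x - grad d f z) \<le> L1 * vnorm (x - z)) \<and>
     (\<forall>x\<in>carrier_vec d. \<forall>z\<in>carrier_vec d.
        opnorm (hess d f x - hess d f z) \<le> L2 * vnorm (x - z))"

definition f_star :: "nat \<Rightarrow> (real vec \<Rightarrow> real) \<Rightarrow> real" where
  "f_star d f = (INF x\<in>carrier_vec d. f x)"

text \<open>
  The minimum is taken over the real eigenvalues. This set is finite, and for a symmetric matrix
  of positive dimension it is nonempty.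
\<close>

definition lambda_min :: "real mat \<Rightarrow> real" where
  "lambda_min A = Min (spectrum A)"

definition second_order_stationary :: "nat \<Rightarrow> (real vec \<Rightarrow> real) \<Rightarrow> real \<Rightarrow> real vec \<Rightarrow> bool" where
  "second_order_stationary d f \<epsilon> x \<longleftrightarrow>
     vnorm (grad d f x) \<le> \<epsilon> \<and> lambda_min (hess d f x) \<ge> - sqrt \<epsilon>"

definition cubic_model :: "nat \<Rightarrow> (real vec \<Rightarrow> real) \<Rightarrow> real \<Rightarrow> real vec \<Rightarrow> real vec \<Rightarrow> real" where
  "cubic_model d f M x s =
     grad d f x \<bullet> s + 1/2 * (s \<bullet> (hess d f x *\<^sub>v s)) + M/6 * vnorm s ^ 3"

text \<open>
  \<open>CRm d f M \<rho> x\<close>: \<open>x\<close> is a sequence of iterates that the algorithm can generate, for some choice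
  of minimizers in the cubic and monotone steps.
\<close>

definition CRm :: "nat \<Rightarrow> (real vec \<Rightarrow> real) \<Rightarrow> real \<Rightarrow> real \<Rightarrow> (nat \<Rightarrow> real vec) \<Rightarrow> bool" where
  "CRm d f M \<rho> x \<longleftrightarrow> x 0 \<in> carrier_vec d \<and>
     (\<exists>s y \<beta> v. y 0 = x 0 \<and>
       (\<forall>k. is_arg_min (cubic_model d f M (x k)) (\<lambda>h. h \<in> carrier_vec d) (s (Suc k)) \<and>
            y (Suc k) = x k + s (Suc k) \<and>
            \<beta> (Suc k) = min \<rho> (min (vnorm (grad d f (y (Suc k)))) (vnorm (y (Suc k) - x k))) \<and>
            v (Suc k) = y (Suc k) + \<beta> (Suc k) \<cdot>\<^sub>v (y (Suc k) - y k) \<and>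
            is_arg_min f (\<lambda>z. z \<in> {y (Suc k), v (Suc k)}) (x (Suc k))))"

end

theory Submission
  imports Defs
begin

text \<open>
  Let \<open>r\<^sub>k\<close> be the length of the cubic step taken at \<open>x\<^sub>k\<close>. A global minimizer of the cubic model
  lowers \<open>f\<close> by at least \<open>M r\<^sub>k\<^sup>3 / 12\<close> (\<open>cubic_step_decrease\<close>), and the monotone step never gives
  any of this back; hence \<open>\<Sum> r\<^sub>k\<^sup>3 \<le> 12 \<Delta> / M\<close>, and among the first \<open>k\<close> steps one has length
  \<open>O(k powr (- 1/3))\<close>. So it is enough that a short step leads to an almost stationary point: the
  gradient at \<open>x\<^sub>k\<^sub>+\<^sub>1\<close> must be \<open>O(r\<^sub>k\<^sup>2)\<close> and the smallest Hessian eigenvalue at least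
  \<open>- O(r\<^sub>k)\<close>. With \<open>r\<^sub>k\<close> of order \<open>sqrt \<epsilon>\<close>, both are what is asked, which explains the number
  \<open>\<epsilon> powr (- 3/2)\<close> of steps.

  At the cubic point \<open>y\<^sub>k\<^sub>+\<^sub>1\<close> the two bounds are the classical ones for cubic regularization. They
  follow from the optimality conditions of the model,
  \<open>g + H s + (M/2) r s = 0\<close> (\<open>residual_eq_0\<close>) and \<open>H + (M/2) r I \<ge> 0\<close> (\<open>curvature_nonneg\<close>), and
  from Taylor's formula for a Lipschitz Hessian (\<open>grad_taylor\<close>, \<open>f_taylor\<close>).

  The momentum step may replace \<open>y\<^sub>k\<^sub>+\<^sub>1\<close> by a point at distance \<open>\<beta>\<^sub>k\<^sub>+\<^sub>1 \<parallel>y\<^sub>k\<^sub>+\<^sub>1 - y\<^sub>k\<parallel>\<close>.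
  The choice of \<open>\<beta>\<close> makes this harmless. As \<open>\<beta> \<le> \<rho> < 1\<close>, the displacements satisfy
  \<open>\<parallel>y\<^sub>k\<^sub>+\<^sub>1 - y\<^sub>k\<parallel> \<le> r\<^sub>k + \<rho> \<parallel>y\<^sub>k - y\<^sub>k\<^sub>-\<^sub>1\<parallel>\<close>, a geometric recursion which keeps them below a
  constant \<open>D\<close> that depends only on \<open>\<rho>\<close>, \<open>M\<close> and \<open>\<Delta>\<close>. As \<open>\<beta>\<close> is also at most
  \<open>\<parallel>\<nabla>f(y\<^sub>k\<^sub>+\<^sub>1)\<parallel>\<close>, the gradient grows at most by the factor \<open>1 + L\<^sub>1 D\<close>, and as \<open>\<beta> \<le> r\<^sub>k\<close>, the point
  stays within \<open>(1 + D) r\<^sub>k\<close> of \<open>x\<^sub>k\<close>, so that the Hessian changes by \<open>O(r\<^sub>k)\<close> only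
  (\<open>momentum_iterates\<close>).

  Both optimality conditions rest on the symmetry of the Hessian, which is obtained from second
  differences (\<open>hess_symmetric\<close>). Symmetry also provides a real eigenvalue
  (\<open>symmetric_spectrum_nonempty\<close>): the minimum of the spectrum is then attained, and a lower bound
  on the quadratic form is a lower bound on it.
\<close>

section \<open>Euclidean geometry of real vectors\<close>

text \<open>
  The distributive laws hold only for vectors of equal dimension. Once that dimension is a fixed
  variable, the side conditions contain no unknown and the simplifier can discharge them.
\<close>

lemmas scalar_prod_expand =
  add_scalar_prod_distrib[where n = d] scalar_prod_add_distrib[where n = d]
  minus_scalar_prod_distrib[where n = d] scalar_prod_minus_distrib[where n = d]
  smult_scalar_prod_distrib[where n = d] scalar_prod_smult_distrib[where n = d]
  mult_add_distrib_mat_vec[where nr = d and nc = d]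
  minus_mult_distrib_mat_vec[where nr = d and nc = d]
  mult_mat_vec[where nr = d and nc = d] for d

lemma scalar_prod_self_nonneg: "0 \<le> (v :: real vec) \<bullet> v"
  unfolding scalar_prod_def by (intro sum_nonneg) simp

lemma vnorm_nonneg [simp]: "0 \<le> vnorm v"
  by (simp add: vnorm_def scalar_prod_self_nonneg)

lemma vnorm_sq: "(vnorm v)\<^sup>2 = v \<bullet> v"
  by (simp add: vnorm_def scalar_prod_self_nonneg)

lemma vnorm_eq_0_iff:
  assumes "v \<in> carrier_vec d"
  shows "vnorm v = 0 \<longleftrightarrow> v = 0\<^sub>v d"
proof
  assume 0: "vnorm v = 0"
  show "v = 0\<^sub>v d"
  proof (rule eq_vecI)
    show "v $ i = 0\<^sub>v d $ i" if "i < dim_vec (0\<^sub>v d)" for i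
      using abs_index_le_vnorm[of i v] 0 that assms by simp
  qed (use assms in simp)
qed (simp add: vnorm_def)

lemma vnorm_smult: "vnorm (t \<cdot>\<^sub>v v) = \<bar>t\<bar> * vnorm v"
  by (simp add: vnorm_def real_sqrt_mult)

text \<open>
  Cauchy-Schwarz: the component of \<open>u\<close> orthogonal to \<open>v\<close>, multiplied by \<open>v \<bullet> v\<close> to avoid
  division, has nonnegative square.
\<close>

lemma scalar_prod_le_vnorm:
  assumes u: "u \<in> carrier_vec d" and v: "v \<in> carrier_vec d"
  shows "\<bar>u \<bullet> v\<bar> \<le> vnorm u * vnorm v"
proof (cases "v \<bullet> v = 0")
  case True
  then have "v = 0\<^sub>v d" using vnorm_eq_0_iff[OF v] by (simp add: vnorm_def)
  then show ?thesis using u by simp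
next
  case False
  then have pos: "v \<bullet> v > 0" using scalar_prod_self_nonneg[of v] by simp
  let ?p = "(v \<bullet> v) \<cdot>\<^sub>v u - (u \<bullet> v) \<cdot>\<^sub>v v"
  have "?p \<bullet> ?p = (v \<bullet> v) * ((v \<bullet> v) * (u \<bullet> u) - (u \<bullet> v)\<^sup>2)"
    using u v by (simp add: scalar_prod_expand[where d = d] comm_scalar_prod[OF v u]
        power2_eq_square algebra_simps)
  then have "(u \<bullet> v)\<^sup>2 \<le> (v \<bullet> v) * (u \<bullet> u)"
    using scalar_prod_self_nonneg[of ?p] pos by (simp add: zero_le_mult_iff)
  then have "(u \<bullet> v)\<^sup>2 \<le> (vnorm u * vnorm v)\<^sup>2"
    by (simp add: power_mult_distrib vnorm_sq mult.commute)
  then show ?thesis by (simp add: abs_le_square_iff[symmetric])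
qed

lemma vnorm_triangle:
  assumes u: "u \<in> carrier_vec d" and v: "v \<in> carrier_vec d"
  shows "vnorm (u + v) \<le> vnorm u + vnorm v"
proof -
  have "(vnorm (u + v))\<^sup>2 = (vnorm u)\<^sup>2 + 2 * (u \<bullet> v) + (vnorm v)\<^sup>2"
    using u v by (simp add: vnorm_sq scalar_prod_expand[where d = d] comm_scalar_prod[OF v u])
  also have "\<dots> \<le> (vnorm u + vnorm v)\<^sup>2"
    using scalar_prod_le_vnorm[OF u v] by (simp add: power2_sum)
  finally show ?thesis by (rule power2_le_imp_le) simp
qed

text \<open>
  Norm bounds are derived from bounds on scalar products \<open>v \<bullet> w\<close> that are linear in \<open>vnorm w\<close>, by
  taking \<open>w = v\<close>.
\<close>

lemma vnorm_le_if_scalar_prod_le: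
  assumes "v \<bullet> v \<le> c * vnorm v" and "0 \<le> c"
  shows "vnorm v \<le> c"
proof (rule ccontr)
  assume "\<not> vnorm v \<le> c"
  then have "c * vnorm v < vnorm v * vnorm v" using assms(2) by (intro mult_strict_right_mono) auto
  with assms(1) show False by (simp add: vnorm_sq power2_eq_square[symmetric])
qed

lemma vnorm_le_sum_abs: "vnorm v \<le> (\<Sum>i<dim_vec v. \<bar>v $ i\<bar>)"
proof -
  have "v \<bullet> v = (\<Sum>i<dim_vec v. \<bar>v $ i\<bar> * \<bar>v $ i\<bar>)"
    by (simp add: scalar_prod_def lessThan_atLeast0)
  also have "\<dots> \<le> (\<Sum>i<dim_vec v. \<bar>v $ i\<bar> * vnorm v)"
    by (intro sum_mono mult_left_mono abs_index_le_vnorm) auto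
  finally show ?thesis
    by (intro vnorm_le_if_scalar_prod_le) (auto simp: sum_distrib_right sum_nonneg)
qed

text \<open>
  The supremum in \<^const>\<open>opnorm\<close> bounds its members only if the set is bounded; here the sum of the
  norms of the rows is a bound.
\<close>

lemma vnorm_mult_mat_vec_le_opnorm:
  assumes A: "A \<in> carrier_mat n d" and v: "v \<in> carrier_vec d"
  shows "vnorm (A *\<^sub>v v) \<le> opnorm A * vnorm v"
proof (cases "vnorm v = 0")
  case True
  then have "A *\<^sub>v v = 0\<^sub>v n" using vnorm_eq_0_iff[OF v] A by auto
  with True show ?thesis by (simp add: vnorm_def)
next
  case False
  let ?r = "vnorm v" and ?u = "(1 / vnorm v) \<cdot>\<^sub>v v"
  have "vnorm (A *\<^sub>v w) \<le> (\<Sum>i<n. vnorm (row A i))"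
    if w: "w \<in> carrier_vec d" and w1: "vnorm w \<le> 1" for w
  proof -
    have "vnorm (A *\<^sub>v w) \<le> (\<Sum>i<n. \<bar>row A i \<bullet> w\<bar>)"
      using vnorm_le_sum_abs[of "A *\<^sub>v w"] A by simp
    also have "\<dots> \<le> (\<Sum>i<n. vnorm (row A i))"
    proof (rule sum_mono)
      fix i assume "i \<in> {..<n}"
      then have "row A i \<in> carrier_vec d" using A by auto
      from scalar_prod_le_vnorm[OF this w] w1
      show "\<bar>row A i \<bullet> w\<bar> \<le> vnorm (row A i)"
        by (meson mult_left_le order_trans vnorm_nonneg)
    qed
    finally show ?thesis .
  qed
  then have bdd: "bdd_above ((\<lambda>w. vnorm (A *\<^sub>v w)) ` {w \<in> carrier_vec d. vnorm w \<le> 1})"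
    by (auto intro!: bdd_aboveI2)
  have "vnorm (A *\<^sub>v ?u) \<le> opnorm A"
    unfolding opnorm_def using A v False
    by (intro cSUP_upper) (use bdd in \<open>auto simp: vnorm_smult\<close>)
  also have "A *\<^sub>v ?u = (1 / ?r) \<cdot>\<^sub>v (A *\<^sub>v v)" using mult_mat_vec[OF A v] .
  finally have "vnorm (A *\<^sub>v v) / ?r \<le> opnorm A" by (simp add: vnorm_smult)
  then show ?thesis using False by (simp add: pos_divide_le_eq less_le)
qed

section \<open>Eigenvalues of symmetric matrices\<close>

text \<open>
  Over the complex numbers there is an eigenvector \<open>a + \<i> b\<close> with eigenvalue \<open>z\<close>. Comparing
  \<open>b \<bullet> A a\<close> with \<open>a \<bullet> A b\<close> gives \<open>Im z * (a \<bullet> a + b \<bullet> b) = 0\<close>, so \<open>z\<close> is real and whichever of \<open>a\<close>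
  and \<open>b\<close> is nonzero is a real eigenvector.
\<close>

lemma symmetric_spectrum_nonempty:
  fixes A :: "real mat"
  assumes A: "A \<in> carrier_mat d d" and d: "d \<ge> 1"
    and sym: "\<And>u v. u \<in> carrier_vec d \<Longrightarrow> v \<in> carrier_vec d \<Longrightarrow> u \<bullet> (A *\<^sub>v v) = v \<bullet> (A *\<^sub>v u)"
  shows "spectrum A \<noteq> {}"
proof -
  let ?A = "map_mat complex_of_real A"
  have cA: "?A \<in> carrier_mat d d" using A by simp
  obtain z v where v: "v \<in> carrier_vec d" "v \<noteq> 0\<^sub>v d" and ev: "?A *\<^sub>v v = z \<cdot>\<^sub>v v"
    using spectrum_non_empty[OF cA] d cA
    by (fastforce simp: spectrum_def eigenvalue_def eigenvector_def)
  let ?a = "map_vec Re v" and ?b = "map_vec Im v"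
  have a: "?a \<in> carrier_vec d" and b: "?b \<in> carrier_vec d" using v by auto
  have entry: "(\<Sum>j<d. complex_of_real (A $$ (i, j)) * v $ j) = z * v $ i" if i: "i < d" for i
  proof -
    have "(?A *\<^sub>v v) $ i = (\<Sum>j<d. complex_of_real (A $$ (i, j)) * v $ j)"
      using A v i by (simp add: scalar_prod_def lessThan_atLeast0)
    then show ?thesis unfolding ev using v i by simp
  qed
  have Aa: "A *\<^sub>v ?a = Re z \<cdot>\<^sub>v ?a - Im z \<cdot>\<^sub>v ?b"
  proof (rule eq_vecI)
    fix i assume "i < dim_vec (Re z \<cdot>\<^sub>v ?a - Im z \<cdot>\<^sub>v ?b)"
    then have i: "i < d" using v by simp
    then show "(A *\<^sub>v ?a) $ i = (Re z \<cdot>\<^sub>v ?a - Im z \<cdot>\<^sub>v ?b) $ i"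
      using arg_cong[OF entry[OF i], of Re] A v by (simp add: scalar_prod_def lessThan_atLeast0)
  qed (use A v in simp)
  have Ab: "A *\<^sub>v ?b = Im z \<cdot>\<^sub>v ?a + Re z \<cdot>\<^sub>v ?b"
  proof (rule eq_vecI)
    fix i assume "i < dim_vec (Im z \<cdot>\<^sub>v ?a + Re z \<cdot>\<^sub>v ?b)"
    then have i: "i < d" using v by simp
    then show "(A *\<^sub>v ?b) $ i = (Im z \<cdot>\<^sub>v ?a + Re z \<cdot>\<^sub>v ?b) $ i"
      using arg_cong[OF entry[OF i], of Im] A v by (simp add: scalar_prod_def lessThan_atLeast0)
  qed (use A v in simp)
  have nz: "?a \<noteq> 0\<^sub>v d \<or> ?b \<noteq> 0\<^sub>v d"
  proof (rule ccontr)
    assume "\<not> ?thesis"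
    then have 0: "?a = 0\<^sub>v d" "?b = 0\<^sub>v d" by auto
    have "v = 0\<^sub>v d"
    proof (rule eq_vecI)
      fix i assume "i < dim_vec (0\<^sub>v d :: complex vec)"
      then have i: "i < d" by simp
      show "v $ i = 0\<^sub>v d $ i"
        using arg_cong[OF 0(1), of "\<lambda>w. w $ i"] arg_cong[OF 0(2), of "\<lambda>w. w $ i"] i v
        by (simp add: complex_eq_iff)
    qed (use v in simp)
    with v show False by simp
  qed
  have "?b \<bullet> (A *\<^sub>v ?a) = ?a \<bullet> (A *\<^sub>v ?b)" by (rule sym[OF b a])
  then have "Im z * (?a \<bullet> ?a + ?b \<bullet> ?b) = 0"
    unfolding Aa Ab using a b
    by (simp add: scalar_prod_expand[where d = d] comm_scalar_prod[OF b a] algebra_simps)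
  moreover have "?a \<bullet> ?a + ?b \<bullet> ?b \<noteq> 0"
    using nz vnorm_eq_0_iff[OF a] vnorm_eq_0_iff[OF b]
      scalar_prod_self_nonneg[of ?a] scalar_prod_self_nonneg[of ?b]
    by (auto simp: vnorm_def)
  ultimately have "Im z = 0" by simp
  then have "A *\<^sub>v ?a = Re z \<cdot>\<^sub>v ?a" "A *\<^sub>v ?b = Re z \<cdot>\<^sub>v ?b"
    unfolding Aa Ab using a b by auto
  then have "eigenvalue A (Re z)"
    unfolding eigenvalue_def eigenvector_def using nz a b carrier_matD(1)[OF A] by metis
  then show ?thesis by (auto simp: spectrum_def)
qed

lemma lambda_min_ge_if_quadratic_form_ge:
  assumes A: "A \<in> carrier_mat d d" and d: "d \<ge> 1"
    and sym: "\<And>u v. u \<in> carrier_vec d \<Longrightarrow> v \<in> carrier_vec d \<Longrightarrow> u \<bullet> (A *\<^sub>v v) = v \<bullet> (A *\<^sub>v u)"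
    and ge: "\<And>w. w \<in> carrier_vec d \<Longrightarrow> w \<bullet> (A *\<^sub>v w) \<ge> c * (w \<bullet> w)"
  shows "lambda_min A \<ge> c"
proof -
  have "c \<le> l" if "l \<in> spectrum A" for l
  proof -
    from that obtain w where w: "w \<in> carrier_vec d" "w \<noteq> 0\<^sub>v d" and ev: "A *\<^sub>v w = l \<cdot>\<^sub>v w"
      using A by (auto simp: spectrum_def eigenvalue_def eigenvector_def)
    have "w \<bullet> w > 0"
      using w vnorm_eq_0_iff[OF w(1)] scalar_prod_self_nonneg[of w]
      by (simp add: vnorm_def less_le)
    moreover have "c * (w \<bullet> w) \<le> l * (w \<bullet> w)" using ge[OF w(1)] w by (simp add: ev)
    ultimately show ?thesis by simp
  qed
  then show ?thesis
    unfolding lambda_min_def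
    using symmetric_spectrum_nonempty[OF A d sym] card_finite_spectrum(1)[OF A] by simp
qed

section \<open>Taylor estimates for a Lipschitz Hessian\<close>

text \<open>
  This replaces passage to the limit in the comparisons of first against second order terms, and
  of second against third order terms.
\<close>

lemma nonpos_if_le_small_multiples:
  fixes a C :: real
  assumes "\<And>t. 0 < t \<Longrightarrow> t \<le> 1 \<Longrightarrow> a \<le> t * C"
  shows "a \<le> 0"
proof (rule ccontr)
  assume "\<not> a \<le> 0"
  then have a: "a > 0" by simp
  define t where "t = min 1 (a / (2 * (\<bar>C\<bar> + 1)))"
  have t: "0 < t" "t \<le> 1" using a by (auto simp: t_def)
  have "t * C \<le> t * (\<bar>C\<bar> + 1)" using t by (intro mult_left_mono) auto
  also have "\<dots> \<le> a / (2 * (\<bar>C\<bar> + 1)) * (\<bar>C\<bar> + 1)" by (intro mult_right_mono) (auto simp: t_def)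
  also have "\<dots> = a / 2" by (simp add: field_simps)
  finally show False using assms[OF t] a by simp
qed

text \<open>
  Scalar calculus becomes available by restriction to lines. In the applications \<open>l\<close> is the Frechet
  derivative at \<open>x + t u\<close>, either of \<open>f\<close> or of a scalar product \<open>\<nabla>f \<bullet> w\<close>.
\<close>

lemma DERIV_along_line:
  assumes x: "x \<in> carrier_vec d" and u: "u \<in> carrier_vec d"
    and lo: "\<And>e. e > 0 \<Longrightarrow> \<exists>\<delta>>0. \<forall>h\<in>carrier_vec d. vnorm h < \<delta> \<longrightarrow>
               \<bar>\<phi> (x + t \<cdot>\<^sub>v u + h) - \<phi> (x + t \<cdot>\<^sub>v u) - l h\<bar> \<le> e * vnorm h"
    and l: "\<And>\<tau>. l (\<tau> \<cdot>\<^sub>v u) = \<tau> * D"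
  shows "((\<lambda>\<tau>. \<phi> (x + \<tau> \<cdot>\<^sub>v u)) has_real_derivative D) (at t)"
proof -
  have "((\<lambda>\<tau>. \<phi> (x + (\<tau> + t) \<cdot>\<^sub>v u)) has_real_derivative D) (at 0)"
  proof (rule DERIV_if_little_o, intro allI impI)
    fix e :: real assume e: "e > 0"
    let ?R = "vnorm u + 1"
    have R: "?R > 0" by (simp add: add_nonneg_pos)
    obtain \<delta> where \<delta>: "\<delta> > 0" and b: "\<And>h. h \<in> carrier_vec d \<Longrightarrow> vnorm h < \<delta> \<Longrightarrow>
        \<bar>\<phi> (x + t \<cdot>\<^sub>v u + h) - \<phi> (x + t \<cdot>\<^sub>v u) - l h\<bar> \<le> e / ?R * vnorm h"
      using lo[of "e / ?R"] e R by (meson divide_pos_pos)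
    have "\<bar>\<phi> (x + (\<tau> + t) \<cdot>\<^sub>v u) - \<phi> (x + (0 + t) \<cdot>\<^sub>v u) - D * \<tau>\<bar> \<le> e * \<bar>\<tau>\<bar>"
      if \<tau>: "\<bar>\<tau>\<bar> < \<delta> / ?R" for \<tau>
    proof -
      have le: "vnorm (\<tau> \<cdot>\<^sub>v u) \<le> \<bar>\<tau>\<bar> * ?R" by (simp add: vnorm_smult algebra_simps)
      also have "\<dots> < \<delta>" using \<tau> R by (simp add: pos_less_divide_eq)
      finally have lt: "vnorm (\<tau> \<cdot>\<^sub>v u) < \<delta>" .
      have eq: "x + (\<tau> + t) \<cdot>\<^sub>v u = x + t \<cdot>\<^sub>v u + \<tau> \<cdot>\<^sub>v u"
        using x u by (intro eq_vecI) (auto simp: algebra_simps)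
      have "\<bar>\<phi> (x + (\<tau> + t) \<cdot>\<^sub>v u) - \<phi> (x + (0 + t) \<cdot>\<^sub>v u) - D * \<tau>\<bar> \<le> e / ?R * vnorm (\<tau> \<cdot>\<^sub>v u)"
        using b[OF _ lt] u by (simp add: eq l mult.commute)
      also have "\<dots> \<le> e / ?R * (\<bar>\<tau>\<bar> * ?R)" using le e R by (intro mult_left_mono) auto
      also have "\<dots> = e * \<bar>\<tau>\<bar>" using R by simp
      finally show ?thesis .
    qed
    moreover have "\<delta> / ?R > 0" using \<delta> R by simp
    ultimately show "\<exists>\<delta>>0. \<forall>\<tau>. \<bar>\<tau>\<bar> < \<delta> \<longrightarrow>
        \<bar>\<phi> (x + (\<tau> + t) \<cdot>\<^sub>v u) - \<phi> (x + (0 + t) \<cdot>\<^sub>v u) - D * \<tau>\<bar> \<le> e * \<bar>\<tau>\<bar>" by blast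
  qed
  then show ?thesis
    using DERIV_shift[of "\<lambda>\<tau>. \<phi> (x + \<tau> \<cdot>\<^sub>v u)" D 0 t] by simp
qed

locale smooth_objective =
  fixes d :: nat and f :: "real vec \<Rightarrow> real" and L1 L2 :: real
  assumes objective: "assumption_A d f L1 L2"
    and L1_nonneg: "0 \<le> L1" and L2_nonneg: "0 \<le> L2"
begin

lemma has_gradient_grad: "x \<in> carrier_vec d \<Longrightarrow> has_gradient d f (grad d f x) x"
  using objective grad_eqI
  unfolding assumption_A_def twice_continuously_differentiable_def by metis

lemma grad_carrier [simp]: "x \<in> carrier_vec d \<Longrightarrow> grad d f x \<in> carrier_vec d"
  using has_gradient_grad by (simp add: has_gradient_def)

lemma has_jacobian_hess: "x \<in> carrier_vec d \<Longrightarrow> has_jacobian d (grad d f) (hess d f x) x"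
  using objective hess_eqI
  unfolding assumption_A_def twice_continuously_differentiable_def by metis

lemma hess_carrier [simp]: "x \<in> carrier_vec d \<Longrightarrow> hess d f x \<in> carrier_mat d d"
  using has_jacobian_hess by (simp add: has_jacobian_def)

lemma hess_mult_carrier [simp]:
  "x \<in> carrier_vec d \<Longrightarrow> u \<in> carrier_vec d \<Longrightarrow> hess d f x *\<^sub>v u \<in> carrier_vec d"
  by (rule mult_mat_vec_carrier[OF hess_carrier])

lemma grad_lipschitz:
  "x \<in> carrier_vec d \<Longrightarrow> z \<in> carrier_vec d \<Longrightarrow>
     vnorm (grad d f x - grad d f z) \<le> L1 * vnorm (x - z)"
  using objective by (simp add: assumption_A_def)

lemma hess_lipschitz:
  assumes "x \<in> carrier_vec d" "z \<in> carrier_vec d" "u \<in> carrier_vec d" "w \<in> carrier_vec d"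
  shows "\<bar>((hess d f x - hess d f z) *\<^sub>v u) \<bullet> w\<bar> \<le> L2 * vnorm (x - z) * vnorm u * vnorm w"
proof -
  let ?B = "hess d f x - hess d f z"
  have B: "?B \<in> carrier_mat d d" by (rule minus_carrier_mat[OF hess_carrier[OF assms(2)]])
  have op: "opnorm ?B \<le> L2 * vnorm (x - z)" using objective assms by (simp add: assumption_A_def)
  have "\<bar>(?B *\<^sub>v u) \<bullet> w\<bar> \<le> vnorm (?B *\<^sub>v u) * vnorm w"
    using B assms by (intro scalar_prod_le_vnorm[where d = d]) auto
  also have "\<dots> \<le> L2 * vnorm (x - z) * vnorm u * vnorm w"
    using vnorm_mult_mat_vec_le_opnorm[OF B assms(3)] mult_right_mono[OF op, of "vnorm u"]
    by (intro mult_right_mono) auto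
  finally show ?thesis .
qed

lemma DERIV_f_along_line:
  assumes x: "x \<in> carrier_vec d" and u: "u \<in> carrier_vec d"
  shows "((\<lambda>t. f (x + t \<cdot>\<^sub>v u)) has_real_derivative grad d f (x + t \<cdot>\<^sub>v u) \<bullet> u) (at t)"
proof (rule DERIV_along_line[OF x u])
  have y: "x + t \<cdot>\<^sub>v u \<in> carrier_vec d" using x u by simp
  show "\<exists>\<delta>>0. \<forall>h\<in>carrier_vec d. vnorm h < \<delta> \<longrightarrow>
      \<bar>f (x + t \<cdot>\<^sub>v u + h) - f (x + t \<cdot>\<^sub>v u) - grad d f (x + t \<cdot>\<^sub>v u) \<bullet> h\<bar> \<le> e * vnorm h"
    if "e > 0" for e
    using has_gradient_grad[OF y] that by (simp add: has_gradient_def)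
  show "grad d f (x + t \<cdot>\<^sub>v u) \<bullet> (\<tau> \<cdot>\<^sub>v u) = \<tau> * (grad d f (x + t \<cdot>\<^sub>v u) \<bullet> u)" for \<tau>
    using u grad_carrier[OF y] by simp
qed

lemma DERIV_grad_along_line:
  assumes x: "x \<in> carrier_vec d" and u: "u \<in> carrier_vec d" and w: "w \<in> carrier_vec d"
  shows "((\<lambda>t. grad d f (x + t \<cdot>\<^sub>v u) \<bullet> w) has_real_derivative
           (hess d f (x + t \<cdot>\<^sub>v u) *\<^sub>v u) \<bullet> w) (at t)"
proof -
  define y where "y = x + t \<cdot>\<^sub>v u"
  have y: "y \<in> carrier_vec d" using x u by (simp add: y_def)
  let ?H = "hess d f y"
  have "\<exists>\<delta>>0. \<forall>h\<in>carrier_vec d. vnorm h < \<delta> \<longrightarrow>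
      \<bar>grad d f (y + h) \<bullet> w - grad d f y \<bullet> w - (?H *\<^sub>v h) \<bullet> w\<bar> \<le> e * vnorm h"
    if e: "e > 0" for e
  proof -
    let ?R = "vnorm w + 1"
    have R: "?R > 0" by (simp add: add_nonneg_pos)
    have "e / ?R > 0" using e R by simp
    then obtain \<delta> where \<delta>: "\<delta> > 0" and b: "\<And>h. h \<in> carrier_vec d \<Longrightarrow> vnorm h < \<delta> \<Longrightarrow>
        vnorm (grad d f (y + h) - grad d f y - ?H *\<^sub>v h) \<le> e / ?R * vnorm h"
      using has_jacobian_hess[OF y] unfolding has_jacobian_def by blast
    have "\<bar>grad d f (y + h) \<bullet> w - grad d f y \<bullet> w - (?H *\<^sub>v h) \<bullet> w\<bar> \<le> e * vnorm h"
      if h: "h \<in> carrier_vec d" and lt: "vnorm h < \<delta>" for h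
    proof -
      let ?r = "grad d f (y + h) - grad d f y - ?H *\<^sub>v h"
      have c: "grad d f (y + h) \<in> carrier_vec d" "grad d f y \<in> carrier_vec d"
        "?H *\<^sub>v h \<in> carrier_vec d" using y h by auto
      have "grad d f (y + h) \<bullet> w - grad d f y \<bullet> w - (?H *\<^sub>v h) \<bullet> w = ?r \<bullet> w"
        using c w by (simp add: scalar_prod_expand[where d = d])
      also have "\<bar>?r \<bullet> w\<bar> \<le> vnorm ?r * vnorm w"
        using c w by (intro scalar_prod_le_vnorm[where d = d]) auto
      also have "\<dots> \<le> (e / ?R * vnorm h) * ?R"
        using b[OF h lt] e R by (intro mult_mono) auto
      also have "\<dots> = e * vnorm h" using R by simp
      finally show ?thesis .
    qed
    with \<delta> show ?thesis by blast
  qed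
  moreover have "(?H *\<^sub>v (\<tau> \<cdot>\<^sub>v u)) \<bullet> w = \<tau> * ((?H *\<^sub>v u) \<bullet> w)" for \<tau>
    using y u w by (simp add: scalar_prod_expand[where d = d])
  ultimately show ?thesis
    unfolding y_def
    by (intro DERIV_along_line[where \<phi> = "\<lambda>z. grad d f z \<bullet> w" and 
          l = "\<lambda>h. (hess d f (x + t \<cdot>\<^sub>v u) *\<^sub>v h) \<bullet> w", OF x u]) auto
qed

text \<open>
  With \<open>w\<close> the remainder itself, the derivative of the scalar remainder
  \<open>(\<nabla>f(x + t s) - \<nabla>f(x) - t H s) \<bullet> w\<close> is at most \<open>L2 t \<parallel>s\<parallel>\<^sup>2 \<parallel>w\<parallel>\<close>, because the Hessian is Lipschitz;
  so the parabola with that slope, minus the remainder, increases on \<open>[0, 1]\<close>.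
\<close>

lemma grad_taylor:
  assumes x: "x \<in> carrier_vec d" and s: "s \<in> carrier_vec d"
  shows "vnorm (grad d f (x + s) - grad d f x - hess d f x *\<^sub>v s) \<le> L2 / 2 * (vnorm s)\<^sup>2"
proof -
  define w where "w = grad d f (x + s) - grad d f x - hess d f x *\<^sub>v s"
  let ?H = "hess d f x"
  have Hs: "?H *\<^sub>v s \<in> carrier_vec d" using x s by simp
  have w: "w \<in> carrier_vec d" using x s Hs by (simp add: w_def)
  define K where "K = L2 * (vnorm s)\<^sup>2 * vnorm w"
  let ?\<psi> = "\<lambda>t. K * t\<^sup>2 / 2 - grad d f (x + t \<cdot>\<^sub>v s) \<bullet> w + t * ((?H *\<^sub>v s) \<bullet> w)"
  have "?\<psi> 0 \<le> ?\<psi> 1"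
  proof (rule DERIV_nonneg_imp_nondecreasing[where f = ?\<psi>])
    fix t :: real assume t: "0 \<le> t" "t \<le> 1"
    let ?y = "x + t \<cdot>\<^sub>v s"
    have y: "?y \<in> carrier_vec d" using x s by simp
    have "(?\<psi> has_real_derivative K * t - (hess d f ?y *\<^sub>v s) \<bullet> w + (?H *\<^sub>v s) \<bullet> w) (at t)"
      by (auto intro!: derivative_eq_intros DERIV_grad_along_line x s w)
    moreover have "?y - x = t \<cdot>\<^sub>v s" using x s by (intro eq_vecI) auto
    then have "\<bar>((hess d f ?y - ?H) *\<^sub>v s) \<bullet> w\<bar> \<le> K * t"
      using hess_lipschitz[OF y x s w] t
      by (simp add: vnorm_smult K_def power2_eq_square ac_simps)
    then have "0 \<le> K * t - (hess d f ?y *\<^sub>v s) \<bullet> w + (?H *\<^sub>v s) \<bullet> w"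
      using x y s w mult_mat_vec_carrier[OF hess_carrier[OF y] s] Hs
      by (simp add: scalar_prod_expand[where d = d])
    ultimately show "\<exists>D. (?\<psi> has_real_derivative D) (at t) \<and> 0 \<le> D" by blast
  qed simp
  moreover have "x + 0 \<cdot>\<^sub>v s = x" "x + 1 \<cdot>\<^sub>v s = x + s" using x s by auto
  moreover have "w \<bullet> w = grad d f (x + s) \<bullet> w - grad d f x \<bullet> w - (?H *\<^sub>v s) \<bullet> w"
  proof -
    have "w \<bullet> w = (grad d f (x + s) - grad d f x - ?H *\<^sub>v s) \<bullet> w" by (simp add: w_def)
    also have "\<dots> = grad d f (x + s) \<bullet> w - grad d f x \<bullet> w - (?H *\<^sub>v s) \<bullet> w"
      using x s w Hs by (simp add: scalar_prod_expand[where d = d])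
    finally show ?thesis .
  qed
  ultimately have "w \<bullet> w \<le> L2 / 2 * (vnorm s)\<^sup>2 * vnorm w" by (simp add: K_def)
  then show ?thesis
    unfolding w_def[symmetric]
    by (rule vnorm_le_if_scalar_prod_le) (use L2_nonneg in simp)
qed

text \<open>
  The same comparison one order higher, with \<open>grad_taylor\<close> as the bound on the derivative.
\<close>

lemma f_taylor:
  assumes x: "x \<in> carrier_vec d" and s: "s \<in> carrier_vec d"
  shows "f (x + s) \<le> f x + grad d f x \<bullet> s + 1/2 * (s \<bullet> (hess d f x *\<^sub>v s)) + L2 / 6 * vnorm s ^ 3"
proof -
  let ?H = "hess d f x" and ?g = "grad d f x"
  have Hs: "?H *\<^sub>v s \<in> carrier_vec d" using x s by simp
  let ?\<psi> = "\<lambda>t. L2 / 6 * vnorm s ^ 3 * t ^ 3 + t * (?g \<bullet> s) + t\<^sup>2 / 2 * (s \<bullet> (?H *\<^sub>v s))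
               - f (x + t \<cdot>\<^sub>v s)"
  have "?\<psi> 0 \<le> ?\<psi> 1"
  proof (rule DERIV_nonneg_imp_nondecreasing[where f = ?\<psi>])
    fix t :: real assume t: "0 \<le> t" "t \<le> 1"
    let ?y = "x + t \<cdot>\<^sub>v s" and ?e = "grad d f (x + t \<cdot>\<^sub>v s) - ?g - ?H *\<^sub>v (t \<cdot>\<^sub>v s)"
    have y: "?y \<in> carrier_vec d" and ts: "t \<cdot>\<^sub>v s \<in> carrier_vec d" using x s by auto
    have e: "?e \<in> carrier_vec d"
      using x y mult_mat_vec_carrier[OF hess_carrier[OF x] ts] by simp
    let ?D = "L2 / 2 * vnorm s ^ 3 * t\<^sup>2 + ?g \<bullet> s + t * (s \<bullet> (?H *\<^sub>v s)) - grad d f ?y \<bullet> s"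
    have "(?\<psi> has_real_derivative ?D) (at t)"
      by (auto intro!: derivative_eq_intros DERIV_f_along_line x s)
    moreover have "?e \<bullet> s \<le> vnorm ?e * vnorm s" using scalar_prod_le_vnorm[OF e s] by simp
    moreover have "vnorm ?e * vnorm s \<le> L2 / 2 * (vnorm (t \<cdot>\<^sub>v s))\<^sup>2 * vnorm s"
      by (intro mult_right_mono grad_taylor x ts) simp
    moreover have "?e \<bullet> s = grad d f ?y \<bullet> s - ?g \<bullet> s - t * (s \<bullet> (?H *\<^sub>v s))"
      using x y s Hs mult_mat_vec[OF hess_carrier[OF x] s, of t]
      by (simp add: scalar_prod_expand[where d = d] comm_scalar_prod[OF Hs s])
    ultimately have "(?\<psi> has_real_derivative ?D) (at t)" "0 \<le> ?D"
      by (auto simp: vnorm_smult power_mult_distrib power2_eq_square power3_eq_cube mult_ac)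
    then show "\<exists>D. (?\<psi> has_real_derivative D) (at t) \<and> 0 \<le> D" by blast
  qed simp
  moreover have "x + 0 \<cdot>\<^sub>v s = x" "x + 1 \<cdot>\<^sub>v s = x + s" using x s by auto
  ultimately show ?thesis by simp
qed

text \<open>
  The mean value theorem for \<open>t \<mapsto> f(x + v + t u) - f(x + t u)\<close> turns the second difference into a
  difference of two gradients, each of which is affine up to the quadratic error of
  \<open>grad_taylor\<close>.
\<close>

lemma second_difference_approx:
  assumes x: "x \<in> carrier_vec d" and u: "u \<in> carrier_vec d" and v: "v \<in> carrier_vec d"
  shows "\<bar>f (x + u + v) - f (x + u) - f (x + v) + f x - u \<bullet> (hess d f x *\<^sub>v v)\<bar>
           \<le> L2 * (vnorm u + vnorm v) ^ 3"
proof -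
  let ?H = "hess d f x"
  let ?R = "vnorm u + vnorm v"
  define e where "e h = grad d f (x + h) - grad d f x - ?H *\<^sub>v h" for h
  have H: "?H *\<^sub>v h \<in> carrier_vec d" if "h \<in> carrier_vec d" for h
    using x that by simp
  have e: "e h \<in> carrier_vec d" if "h \<in> carrier_vec d" for h
    using x that H by (simp add: e_def)
  have e_le: "\<bar>e h \<bullet> u\<bar> \<le> L2 / 2 * ?R ^ 3" if h: "h \<in> carrier_vec d" and R: "vnorm h \<le> ?R" for h
  proof -
    have "\<bar>e h \<bullet> u\<bar> \<le> vnorm (e h) * vnorm u" by (rule scalar_prod_le_vnorm[OF e[OF h] u])
    also have "\<dots> \<le> (L2 / 2 * (vnorm h)\<^sup>2) * ?R"
      unfolding e_def using grad_taylor[OF x h] L2_nonneg by (intro mult_mono) auto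
    also have "\<dots> \<le> L2 / 2 * ?R\<^sup>2 * ?R"
      using R L2_nonneg by (intro mult_right_mono mult_left_mono power_mono) auto
    also have "\<dots> = L2 / 2 * ?R ^ 3" by (simp add: power2_eq_square power3_eq_cube)
    finally show ?thesis .
  qed
  let ?\<psi> = "\<lambda>t. f (x + v + t \<cdot>\<^sub>v u) - f (x + t \<cdot>\<^sub>v u)"
  have "\<exists>t>0. t < 1 \<and> ?\<psi> 1 - ?\<psi> 0 = (1 - 0) * (grad d f (x + v + t \<cdot>\<^sub>v u) \<bullet> u - grad d f (x + t \<cdot>\<^sub>v u) \<bullet> u)"
    by (rule MVT2) (auto intro!: derivative_eq_intros DERIV_f_along_line x u v add_carrier_vec)
  then obtain t where t: "0 < t" "t < 1"
    and eq: "?\<psi> 1 - ?\<psi> 0 = grad d f (x + v + t \<cdot>\<^sub>v u) \<bullet> u - grad d f (x + t \<cdot>\<^sub>v u) \<bullet> u"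
    by auto
  have tu: "t \<cdot>\<^sub>v u \<in> carrier_vec d" and vtu: "v + t \<cdot>\<^sub>v u \<in> carrier_vec d" using u v by auto
  have n1: "vnorm (t \<cdot>\<^sub>v u) \<le> vnorm u"
    using t by (simp add: vnorm_smult mult_left_le_one_le)
  then have n2: "vnorm (v + t \<cdot>\<^sub>v u) \<le> ?R" using vnorm_triangle[OF v tu] by simp
  have "e (v + t \<cdot>\<^sub>v u) \<bullet> u - e (t \<cdot>\<^sub>v u) \<bullet> u
      = grad d f (x + v + t \<cdot>\<^sub>v u) \<bullet> u - grad d f (x + t \<cdot>\<^sub>v u) \<bullet> u - u \<bullet> (?H *\<^sub>v v)"
    using x u v tu vtu H[OF v] H[OF tu] assoc_add_vec[OF x v tu]
      mult_add_distrib_mat_vec[OF hess_carrier[OF x] v tu]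
    by (simp add: e_def scalar_prod_expand[where d = d] comm_scalar_prod[OF H[OF v] u])
  moreover have "x + v + 1 \<cdot>\<^sub>v u = x + u + v" "x + v + 0 \<cdot>\<^sub>v u = x + v" "x + 1 \<cdot>\<^sub>v u = x + u" "x + 0 \<cdot>\<^sub>v u = x"
    using x u v by (auto intro!: eq_vecI)
  moreover have "vnorm (t \<cdot>\<^sub>v u) \<le> ?R" using n1 vnorm_nonneg[of v] by linarith
  ultimately show ?thesis
    using e_le[OF vtu n2] e_le[OF tu] eq by simp
qed

text \<open>
  The second difference is symmetric in its two increments. By \<open>second_difference_approx\<close>, for
  increments \<open>t u\<close> and \<open>t v\<close> the two bilinear values differ by \<open>O(t\<^sup>3)\<close>, while they are quadratic in
  \<open>t\<close>.
\<close>

lemma hess_symmetric: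
  assumes x: "x \<in> carrier_vec d" and u: "u \<in> carrier_vec d" and v: "v \<in> carrier_vec d"
  shows "u \<bullet> (hess d f x *\<^sub>v v) = v \<bullet> (hess d f x *\<^sub>v u)"
proof -
  let ?H = "hess d f x"
  let ?q = "\<bar>u \<bullet> (?H *\<^sub>v v) - v \<bullet> (?H *\<^sub>v u)\<bar>"
  define C where "C = 2 * L2 * (vnorm u + vnorm v) ^ 3"
  have H: "?H *\<^sub>v h \<in> carrier_vec d" if "h \<in> carrier_vec d" for h
    using x that by simp
  have "?q \<le> t * C" if t: "0 < t" for t
  proof -
    have tu: "t \<cdot>\<^sub>v u \<in> carrier_vec d" and tv: "t \<cdot>\<^sub>v v \<in> carrier_vec d" using u v by auto
    have sw: "x + t \<cdot>\<^sub>v v + t \<cdot>\<^sub>v u = x + t \<cdot>\<^sub>v u + t \<cdot>\<^sub>v v" using x u v by (intro eq_vecI) auto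
    have q: "(t \<cdot>\<^sub>v a) \<bullet> (?H *\<^sub>v (t \<cdot>\<^sub>v b)) = t\<^sup>2 * (a \<bullet> (?H *\<^sub>v b))"
      if "a \<in> carrier_vec d" "b \<in> carrier_vec d" for a b
      using that H mult_mat_vec[OF hess_carrier[OF x], of b t]
      by (simp add: scalar_prod_expand[where d = d] power2_eq_square)
    have "\<bar>t\<^sup>2 * (u \<bullet> (?H *\<^sub>v v)) - t\<^sup>2 * (v \<bullet> (?H *\<^sub>v u))\<bar> \<le> 2 * L2 * (t * vnorm u + t * vnorm v) ^ 3"
      using second_difference_approx[OF x tu tv] second_difference_approx[OF x tv tu] t
      by (simp add: sw q u v vnorm_smult add.commute abs_le_iff)
    also have "\<bar>t\<^sup>2 * (u \<bullet> (?H *\<^sub>v v)) - t\<^sup>2 * (v \<bullet> (?H *\<^sub>v u))\<bar> = t\<^sup>2 * ?q"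
      by (simp add: abs_mult flip: right_diff_distrib)
    also have "t * vnorm u + t * vnorm v = t * (vnorm u + vnorm v)" by (simp add: distrib_left)
    also have "2 * L2 * (t * (vnorm u + vnorm v)) ^ 3 = t\<^sup>2 * (t * C)"
      by (simp only: C_def power_mult_distrib) (simp add: power2_eq_square power3_eq_cube)
    finally have "t\<^sup>2 * ?q \<le> t\<^sup>2 * (t * C)" .
    then show ?thesis using t by simp
  qed
  then have "?q \<le> 0" by (rule nonpos_if_le_small_multiples)
  then show ?thesis by simp
qed

end

section \<open>Global minimizers of cubic models\<close>

text \<open>
  The optimality conditions concern only the model, so the gradient and the Hessian are an
  arbitrary vector \<open>g\<close> and an arbitrary symmetric matrix \<open>H\<close>. Below, \<open>residual\<close> is the gradient of the
  model at \<open>s\<close>, and \<open>curvature\<close> is the quadratic form of \<open>H + (M/2) \<parallel>s\<parallel> I\<close>.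
\<close>

locale cubic_minimizer =
  fixes d :: nat and g s :: "real vec" and H :: "real mat" and M :: real
  assumes g [simp]: "g \<in> carrier_vec d" and H: "H \<in> carrier_mat d d"
    and H_symmetric: "\<And>u v. u \<in> carrier_vec d \<Longrightarrow> v \<in> carrier_vec d \<Longrightarrow>
          u \<bullet> (H *\<^sub>v v) = v \<bullet> (H *\<^sub>v u)"
    and M_pos: "0 < M" and s [simp]: "s \<in> carrier_vec d"
    and minimal: "\<And>h. h \<in> carrier_vec d \<Longrightarrow>
          g \<bullet> s + 1/2 * (s \<bullet> (H *\<^sub>v s)) + M/6 * vnorm s ^ 3
            \<le> g \<bullet> h + 1/2 * (h \<bullet> (H *\<^sub>v h)) + M/6 * vnorm h ^ 3"
begin

definition residual :: "real vec" where
  "residual = g + H *\<^sub>v s + (M / 2 * vnorm s) \<cdot>\<^sub>v s"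

definition curvature :: "real vec \<Rightarrow> real" where
  "curvature w = w \<bullet> (H *\<^sub>v w) + M / 2 * vnorm s * (w \<bullet> w)"

lemma Hv [simp]: "v \<in> carrier_vec d \<Longrightarrow> H *\<^sub>v v \<in> carrier_vec d"
  by (rule mult_mat_vec_carrier[OF H])

lemma residual_carrier [simp]: "residual \<in> carrier_vec d"
  by (simp add: residual_def)

text \<open>
  The right-hand side is exactly the increase of the model from \<open>s\<close> to \<open>s + w\<close>. With \<open>r = \<parallel>s\<parallel>\<close> and
  \<open>q = \<parallel>s + w\<parallel>\<close>, the identity \<open>q\<^sup>3 - r\<^sup>3 = (q - r)\<^sup>2 (q + r/2) + (3/2) r (q\<^sup>2 - r\<^sup>2)\<close> splits the cubic term
  into a polynomial of degree two in \<open>w\<close>, which joins \<open>residual\<close> and \<open>curvature\<close>, and a part that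
  vanishes when \<open>q = r\<close>. Thus no derivative of the norm is taken, and \<open>s = 0\<close> is no special case.
\<close>

lemma model_increase_nonneg:
  assumes w: "w \<in> carrier_vec d"
  shows "0 \<le> residual \<bullet> w + 1/2 * curvature w
           + M/6 * ((vnorm (s + w) - vnorm s)\<^sup>2 * (vnorm (s + w) + vnorm s / 2))"
proof -
  let ?r = "vnorm s" and ?q = "vnorm (s + w)"
  have quad: "(s + w) \<bullet> (H *\<^sub>v (s + w)) = s \<bullet> (H *\<^sub>v s) + 2 * ((H *\<^sub>v s) \<bullet> w) + w \<bullet> (H *\<^sub>v w)"
    using w H H_symmetric[OF s w]
    by (simp add: scalar_prod_expand[where d = d] comm_scalar_prod[OF Hv[OF s] w])
  have lin: "g \<bullet> (s + w) = g \<bullet> s + g \<bullet> w"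
    using w by (simp add: scalar_prod_expand[where d = d])
  have sq: "?q\<^sup>2 - ?r\<^sup>2 = 2 * (s \<bullet> w) + w \<bullet> w"
    using w by (simp add: vnorm_sq scalar_prod_expand[where d = d] comm_scalar_prod[OF w s])
  have "?q ^ 3 - ?r ^ 3 = (?q - ?r)\<^sup>2 * (?q + ?r / 2) + 3/2 * ?r * (?q\<^sup>2 - ?r\<^sup>2)"
    by (simp add: power2_eq_square power3_eq_cube algebra_simps)
  then have cube: "?q ^ 3 = ?r ^ 3 + (?q - ?r)\<^sup>2 * (?q + ?r / 2) + 3/2 * ?r * (2 * (s \<bullet> w) + w \<bullet> w)"
    by (simp add: sq)
  have res: "residual \<bullet> w = g \<bullet> w + (H *\<^sub>v s) \<bullet> w + M / 2 * ?r * (s \<bullet> w)"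
    using w by (simp add: residual_def scalar_prod_expand[where d = d])
  have "s + w \<in> carrier_vec d" using w by simp
  from minimal[OF this] show ?thesis
    unfolding quad lin cube res curvature_def by (simp add: algebra_simps)
qed

lemma vnorm_change_le:
  assumes w: "w \<in> carrier_vec d"
  shows "\<bar>vnorm (s + w) - vnorm s\<bar> \<le> vnorm w"
proof -
  have "s = (s + w) + (- 1) \<cdot>\<^sub>v w" using w s by (intro eq_vecI) auto
  then have "vnorm s \<le> vnorm (s + w) + vnorm ((- 1) \<cdot>\<^sub>v w)"
    using vnorm_triangle[of "s + w" d "(- 1) \<cdot>\<^sub>v w"] w by simp
  then show ?thesis using vnorm_triangle[OF s w] by (simp add: vnorm_smult)
qed

lemma curvature_smult:
  assumes w: "w \<in> carrier_vec d"
  shows "curvature (t \<cdot>\<^sub>v w) = t\<^sup>2 * curvature w"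
  using w mult_mat_vec[OF H w, of t]
  by (simp add: curvature_def scalar_prod_expand[where d = d] power2_eq_square algebra_simps)

text \<open>
  In the direction \<open>- residual\<close> the first order term is \<open>- t (residual \<bullet> residual)\<close>, whereas the
  rest of the increase is \<open>O(t\<^sup>2)\<close>.
\<close>

lemma residual_eq_0: "residual = 0\<^sub>v d"
proof -
  let ?p = residual and ?r = "vnorm s"
  have "?p \<bullet> ?p \<le> t * (1/2 * curvature ?p + M/6 * ((vnorm ?p)\<^sup>2 * (2 * ?r + vnorm ?p)))"
    if t: "0 < t" "t \<le> 1" for t
  proof -
    let ?w = "(- t) \<cdot>\<^sub>v ?p" and ?P = "vnorm residual"
    have w: "?w \<in> carrier_vec d" by simp
    have nw: "vnorm ?w = t * ?P" using t by (simp add: vnorm_smult)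
    have "t * ?P \<le> ?P" using t by (simp add: mult_left_le_one_le)
    then have "vnorm (s + ?w) + ?r / 2 \<le> 2 * ?r + ?P"
      using vnorm_change_le[OF w] vnorm_nonneg[of s] unfolding nw by linarith
    moreover have "(vnorm (s + ?w) - ?r)\<^sup>2 \<le> (t * ?P)\<^sup>2"
      using vnorm_change_le[OF w] unfolding nw
      by (metis abs_le_square_iff abs_of_nonneg nw vnorm_nonneg)
    ultimately have "(vnorm (s + ?w) - ?r)\<^sup>2 * (vnorm (s + ?w) + ?r / 2)
        \<le> (t * ?P)\<^sup>2 * (2 * ?r + ?P)"
      by (intro mult_mono) auto
    then have "M/6 * ((vnorm (s + ?w) - ?r)\<^sup>2 * (vnorm (s + ?w) + ?r / 2))
        \<le> M/6 * ((t * ?P)\<^sup>2 * (2 * ?r + ?P))"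
      using M_pos by (intro mult_left_mono) auto
    moreover have "?p \<bullet> ?w = - t * (?p \<bullet> ?p)" by (simp add: scalar_prod_expand[where d = d])
    ultimately have "t * (?p \<bullet> ?p) \<le> 1/2 * (t\<^sup>2 * curvature ?p) + M/6 * ((t * ?P)\<^sup>2 * (2 * ?r + ?P))"
      using model_increase_nonneg[OF w] curvature_smult[OF residual_carrier, of "- t"] by simp
    then have "t * (?p \<bullet> ?p) \<le> t * (t * (1/2 * curvature ?p + M/6 * (?P\<^sup>2 * (2 * ?r + ?P))))"
      by (simp add: power2_eq_square algebra_simps)
    then show ?thesis using t by simp
  qed
  then have "?p \<bullet> ?p \<le> 0" by (rule nonpos_if_le_small_multiples)
  then have "vnorm ?p = 0" using scalar_prod_self_nonneg[of ?p] by (simp add: vnorm_def)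
  then show ?thesis by (simp add: vnorm_eq_0_iff[OF residual_carrier])
qed

text \<open>
  The first order term of the increase being zero, the curvature is decisive as soon as the last
  term is negligible. If \<open>w\<close> is not orthogonal to \<open>s\<close>, the line \<open>s + t w\<close> meets the sphere of radius
  \<open>\<parallel>s\<parallel>\<close> a second time, and there that term vanishes. If \<open>w\<close> is orthogonal to \<open>s\<close>, the norm changes
  by \<open>O(t\<^sup>2)\<close>, or by \<open>t \<parallel>w\<parallel>\<close> in case \<open>s = 0\<close>, and that term is \<open>O(t\<^sup>3)\<close> either way. This is where
  global minimality is used: at a local minimizer the conclusion may fail along \<open>s\<close>.
\<close>

lemma curvature_nonneg:
  assumes w: "w \<in> carrier_vec d"
  shows "0 \<le> curvature w"
proof -
  let ?r = "vnorm s"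
  have inc: "0 \<le> 1/2 * (t\<^sup>2 * curvature w)
      + M/6 * ((vnorm (s + t \<cdot>\<^sub>v w) - ?r)\<^sup>2 * (vnorm (s + t \<cdot>\<^sub>v w) + ?r / 2))" for t
    using model_increase_nonneg[of "t \<cdot>\<^sub>v w"] w by (simp add: residual_eq_0 curvature_smult)
  have sq: "(vnorm (s + t \<cdot>\<^sub>v w))\<^sup>2 = ?r\<^sup>2 + t * (2 * (s \<bullet> w) + t * (w \<bullet> w))" for t
    using w by (simp add: vnorm_sq scalar_prod_expand[where d = d] comm_scalar_prod[OF w s] algebra_simps)
  show ?thesis
  proof (cases "s \<bullet> w = 0")
    case False
    then have "w \<bullet> w \<noteq> 0"
      using vnorm_eq_0_iff[OF w] s by (auto simp: vnorm_def)
    \<comment> \<open>The nonzero solution of \<open>\<parallel>s + t w\<parallel> = \<parallel>s\<parallel>\<close>.\<close>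
    define t where "t = - 2 * (s \<bullet> w) / (w \<bullet> w)"
    have "t \<noteq> 0" using False \<open>w \<bullet> w \<noteq> 0\<close> by (simp add: t_def)
    have "(vnorm (s + t \<cdot>\<^sub>v w))\<^sup>2 = ?r\<^sup>2"
      unfolding sq using \<open>w \<bullet> w \<noteq> 0\<close> by (simp add: t_def)
    then have "vnorm (s + t \<cdot>\<^sub>v w) = ?r" by (simp add: power2_eq_iff_nonneg)
    then show ?thesis using inc[of t] \<open>t \<noteq> 0\<close> by (simp add: zero_le_mult_iff)
  next
    case True
    have "- curvature w \<le> t * (M/3 * vnorm w ^ 3)" if t: "0 < t" for t
    proof -
      let ?q = "vnorm (s + t \<cdot>\<^sub>v w)"
      have diff: "(?q - ?r) * (?q + ?r) = (t * vnorm w)\<^sup>2"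
        using sq[of t] True by (simp add: power2_eq_square algebra_simps vnorm_sq[symmetric])
      have "?q - ?r \<le> t * vnorm w"
        using vnorm_change_le[of "t \<cdot>\<^sub>v w"] w t by (simp add: vnorm_smult)
      moreover have "?r \<le> ?q"
        by (rule power2_le_imp_le) (use sq[of t] True t scalar_prod_self_nonneg[of w] in \<open>simp_all add: zero_le_mult_iff\<close>)
      ultimately have "(?q - ?r) * ((?q - ?r) * (?q + ?r / 2)) \<le> t * vnorm w * (t * vnorm w)\<^sup>2"
        unfolding diff[symmetric] using t by (intro mult_mono) auto
      then have "(?q - ?r)\<^sup>2 * (?q + ?r / 2) \<le> t\<^sup>2 * (t * vnorm w ^ 3)"
        by (simp add: power2_eq_square power3_eq_cube mult_ac)
      then have "M/6 * ((?q - ?r)\<^sup>2 * (?q + ?r / 2)) \<le> M/6 * (t\<^sup>2 * (t * vnorm w ^ 3))"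
        using M_pos by (intro mult_left_mono) auto
      with inc[of t] have "t\<^sup>2 * (- curvature w) \<le> t\<^sup>2 * (t * (M/3 * vnorm w ^ 3))"
        by (simp add: algebra_simps)
      then show ?thesis using t by (simp only: mult_le_cancel_left_pos zero_less_power)
    qed
    then have "- curvature w \<le> 0" by (rule nonpos_if_le_small_multiples)
    then show ?thesis by simp
  qed
qed

text \<open>
  The first order condition, tested with \<open>s\<close>, eliminates \<open>g \<bullet> s\<close> and leaves the value
  \<open>- curvature s / 2 - (M/12) \<parallel>s\<parallel>\<^sup>3\<close>.
\<close>

lemma model_decrease:
  "g \<bullet> s + 1/2 * (s \<bullet> (H *\<^sub>v s)) + M/6 * vnorm s ^ 3 \<le> - (M/12 * vnorm s ^ 3)"
proof -
  have cube: "vnorm s * (s \<bullet> s) = vnorm s ^ 3"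
    by (simp add: vnorm_sq[symmetric] power2_eq_square power3_eq_cube)
  have "residual \<bullet> s = g \<bullet> s + s \<bullet> (H *\<^sub>v s) + M / 2 * (vnorm s * (s \<bullet> s))"
    by (simp add: residual_def scalar_prod_expand[where d = d] comm_scalar_prod[OF Hv[OF s] s])
  then have "g \<bullet> s + s \<bullet> (H *\<^sub>v s) + M / 2 * vnorm s ^ 3 = 0"
    by (simp add: residual_eq_0 cube)
  moreover have "0 \<le> s \<bullet> (H *\<^sub>v s) + M / 2 * vnorm s ^ 3"
    using curvature_nonneg[OF s] cube by (simp add: curvature_def mult.assoc)
  ultimately show ?thesis by simp
qed

lemma vnorm_model_gradient: "vnorm (g + H *\<^sub>v s) = M / 2 * (vnorm s)\<^sup>2"
proof -
  define c where "c = - (M / 2 * vnorm s)"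
  have "g + H *\<^sub>v s = c \<cdot>\<^sub>v s"
  proof (rule eq_vecI)
    fix i assume "i < dim_vec (c \<cdot>\<^sub>v s)"
    then have i: "i < d" using s by auto
    then have "residual $ i = 0" by (simp add: residual_eq_0)
    then have "g $ i + (H *\<^sub>v s) $ i = c * s $ i"
      using i carrier_vecD[OF s] carrier_vecD[OF g] carrier_vecD[OF Hv[OF s]]
      by (simp add: residual_def c_def del: index_mult_mat_vec)
    moreover have "(c \<cdot>\<^sub>v s) $ i = c * s $ i"
      using i by (simp add: carrier_vecD[OF s])
    moreover have "(g + H *\<^sub>v s) $ i = g $ i + (H *\<^sub>v s) $ i"
      using i carrier_vecD[OF Hv[OF s]] by (intro index_add_vec) simp
    ultimately show "(g + H *\<^sub>v s) $ i = (c \<cdot>\<^sub>v s) $ i" by metis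
  qed (simp add: carrier_vecD[OF s] carrier_matD[OF H])
  then show ?thesis using M_pos by (simp add: c_def vnorm_smult abs_mult power2_eq_square)
qed

end

context smooth_objective
begin

lemma cubic_minimizer_if_arg_min:
  assumes x: "x \<in> carrier_vec d" and M: "0 < M"
    and s: "is_arg_min (cubic_model d f M x) (\<lambda>h. h \<in> carrier_vec d) s"
  shows "cubic_minimizer d (grad d f x) s (hess d f x) M"
  using x M s by unfold_locales
    (auto simp: hess_symmetric is_arg_min_linorder cubic_model_def)

lemma cubic_step_decrease:
  assumes x: "x \<in> carrier_vec d" and M: "L2 \<le> M" "0 < M"
    and s: "is_arg_min (cubic_model d f M x) (\<lambda>h. h \<in> carrier_vec d) s"
  shows "f (x + s) \<le> f x - M/12 * vnorm s ^ 3"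
proof -
  interpret cubic_minimizer d "grad d f x" s "hess d f x" M
    by (rule cubic_minimizer_if_arg_min[OF x M(2) s])
  have "L2 / 6 * vnorm s ^ 3 \<le> M / 6 * vnorm s ^ 3" using M by (intro mult_right_mono) auto
  then show ?thesis using f_taylor[OF x] s model_decrease by (fastforce simp: is_arg_min_def)
qed

lemma cubic_step_grad:
  assumes x: "x \<in> carrier_vec d" and M: "0 < M"
    and s: "is_arg_min (cubic_model d f M x) (\<lambda>h. h \<in> carrier_vec d) s"
  shows "vnorm (grad d f (x + s)) \<le> (L2 + M) / 2 * (vnorm s)\<^sup>2"
proof -
  interpret cubic_minimizer d "grad d f x" s "hess d f x" M
    by (rule cubic_minimizer_if_arg_min[OF x M s])
  have sc: "s \<in> carrier_vec d" using s by (simp add: is_arg_min_def)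
  let ?e = "grad d f (x + s) - grad d f x - hess d f x *\<^sub>v s"
  have c: "grad d f (x + s) \<in> carrier_vec d" using x sc by simp
  note dims = carrier_matD[OF hess_carrier[OF x]] carrier_vecD[OF c] carrier_vecD[OF g] carrier_vecD[OF Hv[OF sc]]
  have "grad d f (x + s) = ?e + (grad d f x + hess d f x *\<^sub>v s)"
    by (intro eq_vecI) (auto simp: dims)
  then have "vnorm (grad d f (x + s)) \<le> vnorm ?e + vnorm (grad d f x + hess d f x *\<^sub>v s)"
    using vnorm_triangle[of ?e d "grad d f x + hess d f x *\<^sub>v s"] c sc g Hv
    by simp
  then show ?thesis using grad_taylor[OF x sc] vnorm_model_gradient by (simp add: algebra_simps)
qed

text \<open>
  The quadratic form of the Hessian at \<open>x\<close> is bounded below by \<open>curvature_nonneg\<close>, and the Lipschitz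
  condition carries the bound over to \<open>z\<close>. The point \<open>z\<close> is arbitrary because the iterate that
  follows \<open>x\<close> need not be the cubic point \<open>x + s\<close>.
\<close>

lemma lambda_min_near_cubic_step:
  assumes x: "x \<in> carrier_vec d" and z: "z \<in> carrier_vec d" and M: "0 < M" and d: "d \<ge> 1"
    and s: "is_arg_min (cubic_model d f M x) (\<lambda>h. h \<in> carrier_vec d) s"
  shows "lambda_min (hess d f z) \<ge> - (M / 2 * vnorm s + L2 * vnorm (z - x))"
proof (rule lambda_min_ge_if_quadratic_form_ge[OF hess_carrier[OF z] d hess_symmetric[OF z]])
  interpret cubic_minimizer d "grad d f x" s "hess d f x" M
    by (rule cubic_minimizer_if_arg_min[OF x M s])
  fix w :: "real vec" assume w: "w \<in> carrier_vec d"
  have Hw: "hess d f x *\<^sub>v w \<in> carrier_vec d" "hess d f z *\<^sub>v w \<in> carrier_vec d" using w x z by auto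
  have "((hess d f z - hess d f x) *\<^sub>v w) \<bullet> w = w \<bullet> (hess d f z *\<^sub>v w) - w \<bullet> (hess d f x *\<^sub>v w)"
    using w Hw hess_carrier[OF x] hess_carrier[OF z]
    by (simp add: scalar_prod_expand[where d = d] comm_scalar_prod[OF _ w])
  moreover have "\<bar>((hess d f z - hess d f x) *\<^sub>v w) \<bullet> w\<bar> \<le> L2 * vnorm (z - x) * (w \<bullet> w)"
    using hess_lipschitz[OF z x w w] by (simp add: vnorm_sq[symmetric] power2_eq_square mult.assoc)
  ultimately show "- (M / 2 * vnorm s + L2 * vnorm (z - x)) * (w \<bullet> w) \<le> w \<bullet> (hess d f z *\<^sub>v w)"
    using curvature_nonneg[OF w] by (simp add: curvature_def algebra_simps)
qed

end

section \<open>Iterates of the momentum method\<close>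

text \<open>
  A crude substitute for the cube root: the bound on the length of a step only has to depend on the
  parameters of the method.
\<close>

lemma le_one_plus_if_cube_le:
  fixes r a :: real
  assumes "r ^ 3 \<le> a" and "0 \<le> a"
  shows "r \<le> 1 + a"
proof (rule ccontr)
  assume "\<not> r \<le> 1 + a"
  then have r: "1 + a < r" by simp
  then have "r \<le> r ^ 3" using assms(2) self_le_power[of r 3] by simp
  then show False using r assms by simp
qed

context smooth_objective
begin

lemma f_star_le: "z \<in> carrier_vec d \<Longrightarrow> f_star d f \<le> f z"
  using objective unfolding f_star_def assumption_A_def by (auto intro: cINF_lower)

text \<open>
  \<open>D\<close> is the fixed point \<open>S + \<rho> D = D\<close> of the recursion for \<open>\<parallel>y\<^sub>k\<^sub>+\<^sub>1 - y\<^sub>k\<parallel>\<close>, with the bound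
  \<open>S = 1 + 12 \<Delta> / M\<close> on the length of every step.
\<close>

lemma momentum_iterates:
  assumes d: "d \<ge> 1" and M: "L2 \<le> M" "0 < M" and \<rho>: "0 \<le> \<rho>" "\<rho> < 1"
    and gap: "f (x 0) - f_star d f = \<Delta>" and CRm: "CRm d f M \<rho> x"
    and D_def: "D = (1 + 12 * \<Delta> / M) / (1 - \<rho>)"
  obtains r where "\<And>k. 0 \<le> r k"
    and "\<And>n. (\<Sum>i<n. r i ^ 3) \<le> 12 * \<Delta> / M"
    and "\<And>k. vnorm (grad d f (x (Suc k))) \<le> (1 + L1 * D) * ((L2 + M) / 2) * (r k)\<^sup>2"
    and "\<And>k. lambda_min (hess d f (x (Suc k))) \<ge> - ((M / 2 + L2 * (1 + D)) * r k)"
proof -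
  from CRm obtain s y \<beta> v where x0: "x 0 \<in> carrier_vec d" and y0: "y 0 = x 0"
    and s: "\<And>k. is_arg_min (cubic_model d f M (x k)) (\<lambda>h. h \<in> carrier_vec d) (s (Suc k))"
    and y: "\<And>k. y (Suc k) = x k + s (Suc k)"
    and \<beta>: "\<And>k. \<beta> (Suc k) = min \<rho> (min (vnorm (grad d f (y (Suc k)))) (vnorm (y (Suc k) - x k)))"
    and v: "\<And>k. v (Suc k) = y (Suc k) + \<beta> (Suc k) \<cdot>\<^sub>v (y (Suc k) - y k)"
    and arg: "\<And>k. is_arg_min f (\<lambda>z. z \<in> {y (Suc k), v (Suc k)}) (x (Suc k))"
    unfolding CRm_def by blast
  define r where "r k = vnorm (s (Suc k))" for k
  have sc: "s (Suc k) \<in> carrier_vec d" for k using s[of k] by (simp add: is_arg_min_def)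
  have x_cases: "x (Suc k) = y (Suc k) \<or> x (Suc k) = v (Suc k)" for k
    using arg[of k] by (auto simp: is_arg_min_def)
  have xy: "x k \<in> carrier_vec d \<and> y k \<in> carrier_vec d" for k
  proof (induction k)
    case (Suc k)
    then have "y (Suc k) \<in> carrier_vec d" using sc by (simp add: y)
    then show ?case using Suc x_cases[of k] by (auto simp: v)
  qed (simp add: x0 y0)
  have xc: "x k \<in> carrier_vec d" and yc: "y k \<in> carrier_vec d" for k using xy by auto

  have "f (x (Suc k)) \<le> f (y (Suc k))" for k
    using arg[of k] by (auto simp: is_arg_min_linorder)
  then have decrease: "f (x (Suc k)) \<le> f (x k) - M/12 * r k ^ 3" for k
    using cubic_step_decrease[OF xc M s, of k] by (simp add: y r_def) (meson order_trans)
  have "M/12 * (\<Sum>i<n. r i ^ 3) \<le> f (x 0) - f (x n)" for n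
  proof (induction n)
    case (Suc n)
    then show ?case using decrease[of n] by (simp add: distrib_left)
  qed simp
  then have "M/12 * (\<Sum>i<n. r i ^ 3) \<le> \<Delta>" for n
    using f_star_le[OF xc, of n] gap by (smt (verit))
  then have sum_le: "(\<Sum>i<n. r i ^ 3) \<le> 12 * \<Delta> / M" for n
    using M by (simp add: pos_le_divide_eq mult.commute)
  have r0: "0 \<le> r k" for k by (simp add: r_def)
  have "r k ^ 3 \<le> 12 * \<Delta> / M" for k
    by (rule order_trans[OF member_le_sum sum_le[of "Suc k"]]) (auto simp: r0)
  then have r_le: "r k \<le> 1 + 12 * \<Delta> / M" for k
    using sum_le[of 0] by (intro le_one_plus_if_cube_le) auto

  have yx: "y (Suc k) - x k = s (Suc k)" for k
    unfolding y using xc[of k] sc[of k] by (intro eq_vecI) auto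
  have \<beta>0: "0 \<le> \<beta> (Suc k)" and \<beta>\<rho>: "\<beta> (Suc k) \<le> \<rho>" and \<beta>r: "\<beta> (Suc k) \<le> r k"
    and \<beta>g: "\<beta> (Suc k) \<le> vnorm (grad d f (y (Suc k)))" for k
    using \<rho> by (auto simp: \<beta> yx r_def)
  have dyc: "y (Suc k) - y k \<in> carrier_vec d" for k by (rule minus_carrier_vec[OF yc yc])
  have "(1 - \<rho>) * D = 1 + 12 * \<Delta> / M" using \<rho> by (simp add: D_def)
  then have D: "1 + 12 * \<Delta> / M + \<rho> * D = D" by (simp add: algebra_simps)
  have D0: "0 \<le> D" using sum_le[of 0] \<rho> by (simp add: D_def)
  have momentum: "vnorm (x (Suc k) - y (Suc k)) \<le> \<beta> (Suc k) * vnorm (y (Suc k) - y k)" for k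
  proof -
    have "x (Suc k) - y (Suc k) = 0\<^sub>v d
        \<or> x (Suc k) - y (Suc k) = \<beta> (Suc k) \<cdot>\<^sub>v (y (Suc k) - y k)"
      using x_cases[of k]
    proof
      assume "x (Suc k) = y (Suc k)" then show ?thesis using yc[of "Suc k"] by simp
    next
      assume "x (Suc k) = v (Suc k)"
      then have "x (Suc k) - y (Suc k) = \<beta> (Suc k) \<cdot>\<^sub>v (y (Suc k) - y k)"
        unfolding v using carrier_vecD[OF yc[of "Suc k"]] carrier_vecD[OF yc[of k]]
        by (intro eq_vecI) auto
      then show ?thesis ..
    qed
    moreover have "vnorm (0\<^sub>v d) = 0" by (simp add: vnorm_def)
    ultimately show ?thesis using \<beta>0[of k] by (auto simp: vnorm_smult)
  qed
  have dy_step: "vnorm (y (Suc k) - y k) \<le> r k + vnorm (x k - y k)" for k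
  proof -
    have "y (Suc k) - y k = s (Suc k) + (x k - y k)"
      unfolding y using carrier_vecD[OF xc[of k]] carrier_vecD[OF yc[of k]] carrier_vecD[OF sc[of k]]
      by (intro eq_vecI) auto
    then show ?thesis
      using vnorm_triangle[OF sc minus_carrier_vec[OF xc yc]] by (simp add: r_def)
  qed
  \<comment> \<open>This bound is what reproduces itself: with it the next displacement is at most \<open>S + \<rho> D = D\<close>.\<close>
  have xy_le: "vnorm (x k - y k) \<le> \<rho> * D" for k
  proof (induction k)
    case 0
    have "x 0 - y 0 = 0\<^sub>v d" using x0 by (simp add: y0)
    then show ?case using \<rho> D0 by (simp add: vnorm_def)
  next
    case (Suc k)
    then have "vnorm (y (Suc k) - y k) \<le> D" using dy_step[of k] r_le[of k] D by linarith
    then have "\<beta> (Suc k) * vnorm (y (Suc k) - y k) \<le> \<rho> * D"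
      using \<beta>0[of k] \<beta>\<rho>[of k] \<rho> by (intro mult_mono) auto
    then show ?case using momentum[of k] by linarith
  qed
  have dy_le: "vnorm (y (Suc k) - y k) \<le> D" for k
    using dy_step[of k] r_le[of k] xy_le[of k] D by linarith

  show thesis
  proof (rule that[of r])
    fix k
    let ?X = "x (Suc k)" and ?Y = "y (Suc k)"
    have mom: "vnorm (?X - ?Y) \<le> \<beta> (Suc k) * D"
      using momentum[of k] mult_left_mono[OF dy_le \<beta>0, of k k] by linarith
    have decomp: "a = (a - b) + b" if "a \<in> carrier_vec d" "b \<in> carrier_vec d" for a b :: "real vec"
      using that by (intro eq_vecI) auto
    \<comment> \<open>The momentum weight is bounded by the gradient at the cubic point, so the change is relative.\<close>
    have "vnorm (grad d f ?X) \<le> vnorm (grad d f ?X - grad d f ?Y) + vnorm (grad d f ?Y)"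
      using vnorm_triangle[of "grad d f ?X - grad d f ?Y" d "grad d f ?Y"] xc yc
        decomp[of "grad d f ?X" "grad d f ?Y"] by simp
    also have "vnorm (grad d f ?X - grad d f ?Y) \<le> L1 * vnorm (?X - ?Y)"
      by (rule grad_lipschitz[OF xc yc])
    also have "\<dots> \<le> L1 * (vnorm (grad d f ?Y) * D)"
      using mom mult_right_mono[OF \<beta>g[of k] D0] L1_nonneg by (intro mult_left_mono) auto
    finally have "vnorm (grad d f ?X) \<le> (1 + L1 * D) * vnorm (grad d f ?Y)"
      by (simp add: algebra_simps)
    also have "\<dots> \<le> (1 + L1 * D) * ((L2 + M) / 2 * (r k)\<^sup>2)"
      using cubic_step_grad[OF xc M(2) s, of k] L1_nonneg D0
      by (intro mult_left_mono) (auto simp: y r_def)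
    finally show "vnorm (grad d f ?X) \<le> (1 + L1 * D) * ((L2 + M) / 2) * (r k)\<^sup>2"
      by (simp add: mult.assoc)
    \<comment> \<open>Here the bound of the momentum weight by the step length is the useful one.\<close>
    have "?X - x k = (?X - ?Y) + s (Suc k)"
      unfolding yx[symmetric]
      using carrier_vecD[OF xc[of k]] carrier_vecD[OF yc[of "Suc k"]] carrier_vecD[OF xc[of "Suc k"]]
      by (intro eq_vecI) auto
    then have "vnorm (?X - x k) \<le> vnorm (?X - ?Y) + r k"
      using vnorm_triangle[OF minus_carrier_vec[OF xc yc] sc] by (simp add: r_def)
    also have "\<dots> \<le> (1 + D) * r k"
      using mom mult_right_mono[OF \<beta>r[of k] D0] by (simp add: algebra_simps)
    finally have "L2 * vnorm (?X - x k) \<le> L2 * ((1 + D) * r k)"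
      using L2_nonneg by (rule mult_left_mono)
    then show "lambda_min (hess d f ?X) \<ge> - ((M / 2 + L2 * (1 + D)) * r k)"
      using lambda_min_near_cubic_step[OF xc xc M(2) d s, of k "Suc k"]
      by (simp add: r_def algebra_simps)
  qed (use r0 sum_le in auto)
qed

end

lemma sqrt_cubed_eq_powr:
  assumes "0 < (\<epsilon> :: real)"
  shows "sqrt \<epsilon> ^ 3 = \<epsilon> powr (3/2)"
  using assms by (simp add: powr_half_sqrt[symmetric] powr_realpow[symmetric] powr_powr)

lemma exists_small_term_if_cubes_summable:
  fixes r :: "nat \<Rightarrow> real"
  assumes sum: "(\<Sum>i<k. r i ^ 3) \<le> B" and k: "B < real k * \<delta> ^ 3" and \<delta>: "0 \<le> \<delta>"
  obtains i where "i < k" and "r i \<le> \<delta>"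
proof -
  have "\<exists>i<k. r i \<le> \<delta>"
  proof (rule ccontr)
    assume "\<not> (\<exists>i<k. r i \<le> \<delta>)"
    then have "(\<Sum>i<k. \<delta> ^ 3) \<le> (\<Sum>i<k. r i ^ 3)"
      using \<delta> by (intro sum_mono power_mono) (auto simp: not_le less_imp_le)
    then show False using sum k by simp
  qed
  with that show thesis by blast
qed

theorem theorem1:
  fixes L1 L2 M \<rho> \<Delta> :: real
  assumes "L1 > 0" and "L2 > 0" and "M > L2" and "0 \<le> \<rho>" and "\<rho> < 1" and "\<Delta> \<ge> 0"
  shows "\<exists>C>0. \<forall>d f x0 x. d \<ge> 1 \<longrightarrow> assumption_A d f L1 L2 \<longrightarrow>
           x0 \<in> carrier_vec d \<longrightarrow> f x0 - f_star d f = \<Delta> \<longrightarrow>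
           CRm d f M \<rho> x \<longrightarrow> x 0 = x0 \<longrightarrow>
           (\<forall>\<epsilon> k. 0 < \<epsilon> \<longrightarrow> \<epsilon> \<le> 1 \<longrightarrow> real k \<ge> C / \<epsilon> powr (3/2) \<longrightarrow>
              (\<exists>i\<le>k. second_order_stationary d f \<epsilon> (x i)))"
proof -
  define D where "D = (1 + 12 * \<Delta> / M) / (1 - \<rho>)"
  define Kg where "Kg = (1 + L1 * D) * ((L2 + M) / 2)"
  define Kh where "Kh = M / 2 + L2 * (1 + D)"
  \<comment> \<open>The summand 1 gives \<open>K \<le> K\<^sup>2\<close>, so that \<open>K * r \<le> sqrt \<epsilon>\<close> serves gradient and curvature alike.\<close>
  define K where "K = 1 + Kg + Kh"
  \<comment> \<open>The 1 keeps \<open>C\<close> positive for \<open>\<Delta> = 0\<close> and makes the count of short steps strict.\<close>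
  define C where "C = (12 * \<Delta> / M + 1) * K ^ 3"
  have M: "0 < M" using assms by simp
  have "0 \<le> D" using assms M by (simp add: D_def)
  then have "0 \<le> Kg" "0 \<le> Kh" using assms M by (auto simp: Kg_def Kh_def)
  then have K: "1 \<le> K" "Kg \<le> K" "Kh \<le> K" by (auto simp: K_def)
  have "0 \<le> 12 * \<Delta> / M" using assms M by simp
  then have C: "0 < C" using K by (simp add: C_def add_nonneg_pos)
  have "\<exists>i\<le>k. second_order_stationary d f \<epsilon> (x i)"
    if d: "d \<ge> 1" and A: "assumption_A d f L1 L2" and gap: "f (x 0) - f_star d f = \<Delta>"
      and CRm: "CRm d f M \<rho> x" and \<epsilon>: "0 < \<epsilon>" and k: "C / \<epsilon> powr (3/2) \<le> real k"
    for d f x \<epsilon> k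
  proof -
    interpret smooth_objective d f L1 L2
      using A assms by unfold_locales auto
    obtain r where r0: "\<And>k. 0 \<le> r k"
      and sum: "\<And>n. (\<Sum>i<n. r i ^ 3) \<le> 12 * \<Delta> / M"
      and grad: "\<And>k. vnorm (grad d f (x (Suc k))) \<le> Kg * (r k)\<^sup>2"
      and curv: "\<And>k. lambda_min (hess d f (x (Suc k))) \<ge> - (Kh * r k)"
      unfolding Kg_def Kh_def
      using momentum_iterates[OF d less_imp_le[OF assms(3)] M assms(4,5) gap CRm D_def] by blast
    define \<delta> where "\<delta> = sqrt \<epsilon> / K"
    have \<delta>0: "0 \<le> \<delta>" using \<epsilon> K by (simp add: \<delta>_def)
    have "C \<le> real k * sqrt \<epsilon> ^ 3"
      using k \<epsilon> by (simp add: sqrt_cubed_eq_powr pos_divide_le_eq)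
    then have "12 * \<Delta> / M + 1 \<le> real k * \<delta> ^ 3"
      using K by (simp add: C_def \<delta>_def power_divide pos_le_divide_eq)
    then have "12 * \<Delta> / M < real k * \<delta> ^ 3" by simp
    from exists_small_term_if_cubes_summable[OF sum this \<delta>0]
    obtain i where i: "i < k" and "r i \<le> \<delta>" .
    then have Kr: "K * r i \<le> sqrt \<epsilon>" using K by (simp add: \<delta>_def pos_le_divide_eq mult.commute)
    have "Kg * (r i)\<^sup>2 \<le> K\<^sup>2 * (r i)\<^sup>2"
      using K self_le_power[of K 2] by (intro mult_right_mono) auto
    also have "\<dots> = (K * r i)\<^sup>2" by (simp add: power_mult_distrib)
    also have "\<dots> \<le> (sqrt \<epsilon>)\<^sup>2" using Kr K r0 by (intro power_mono) auto
    also have "\<dots> = \<epsilon>" using \<epsilon> by simp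
    finally have "vnorm (grad d f (x (Suc i))) \<le> \<epsilon>" using grad[of i] by linarith
    moreover have "Kh * r i \<le> K * r i" using K r0 by (intro mult_right_mono) auto
    then have "lambda_min (hess d f (x (Suc i))) \<ge> - sqrt \<epsilon>" using curv[of i] Kr by linarith
    ultimately show ?thesis using i by (auto simp: second_order_stationary_def intro!: exI[of _ "Suc i"])
  qed
  then show ?thesis using C by blast
qed

end
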